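(* There is an absolute constant $K>0$ such that for every sufficiently large $n$ there is an instance of online maximum-weight independent set on an interval graph with at most $n$ nodes, both in the secretary model and in the prophet-inequality model, on which every (possibly randomized) online algorithm satisfies $\mathbb{E}[\mathrm{ALG}]\le K\,\frac{\log^2\log n}{\log n}\,\mathbb{E}[\mathrm{OPT}]$. In other words, the competitive ratio of every online algorithm is $\Omega(\log n/\log^2\log n)$, even on interval graphs and even in these two models.
   Context: Online maximum-weight independent set: nodes of a node-weighted graph arrive one at a time; on arrival the algorithm learns the node's weight and its edges to earlier nodes, and irrevocably accepts or rejects it, keeping the accepted set independent. $\mathrm{ALG}$ is the weight of the accepted set and $\mathrm{OPT}$ the maximum weight of an independent set. Secretary model: an adversary fixes the weighted graph (the algorithm knows the number of nodes), and nodes arrive in uniformly random order. Prophet-inequality model: the adversary fixes the graph and independent weight distributions for the nodes, both known to the algorithm, and the arrival order; each realized weight is revealed on arrival. An interval graph is the intersection graph of a finite family of intervals of the real line. *)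

theory Defs
  imports "HOL-Probability.Probability" "HOL-Combinatorics.Permutations"
begin

text \<open>Graphs have a finite vertex set of natural numbers and an adjacency predicate, of which
  only the restriction to the vertex set matters.\<close>

definition interval_graph :: "nat set \<Rightarrow> (nat \<Rightarrow> nat \<Rightarrow> bool) \<Rightarrow> bool" where
  "interval_graph V E \<longleftrightarrow> finite V \<and>
     (\<exists>I :: nat \<Rightarrow> real set.
        (\<forall>v\<in>V. is_interval (I v) \<and> I v \<noteq> {}) \<and>
        (\<forall>u\<in>V. \<forall>v\<in>V. E u v \<longleftrightarrow> u \<noteq> v \<and> I u \<inter> I v \<noteq> {}))"

definition independent_set :: "nat set \<Rightarrow> (nat \<Rightarrow> nat \<Rightarrow> bool) \<Rightarrow> nat set \<Rightarrow> bool" where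
  "independent_set V E S \<longleftrightarrow> S \<subseteq> V \<and> (\<forall>u\<in>S. \<forall>v\<in>S. \<not> E u v)"

definition OPT :: "nat set \<Rightarrow> (nat \<Rightarrow> nat \<Rightarrow> bool) \<Rightarrow> (nat \<Rightarrow> real) \<Rightarrow> real" where
  "OPT V E w = Max {\<Sum>v\<in>S. w v | S. independent_set V E S}"

text \<open>What is revealed when a node arrives: its weight and the set of arrival times of its
  earlier neighbours. The name of the node is not revealed: in the secretary model an algorithm
  that may depend on the instance could otherwise simply accept a fixed optimal set.\<close>

type_synonym observation = "real \<times> nat set"

text \<open>The node arriving at time \<open>t\<close> is \<open>\<pi> t\<close>.\<close>

definition observations ::
    "nat \<Rightarrow> (nat \<Rightarrow> nat \<Rightarrow> bool) \<Rightarrow> (nat \<Rightarrow> real) \<Rightarrow> (nat \<Rightarrow> nat) \<Rightarrow> observation list" where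
  "observations m E w \<pi> = map (\<lambda>t. (w (\<pi> t), {s. s < t \<and> E (\<pi> s) (\<pi> t)})) [0..<m]"

text \<open>A decision rule gets the random seed and everything observed so far, the current
  arrival last, and says whether the current node is accepted. Its earlier decisions are
  determined by the same data.\<close>

type_synonym decision_rule = "real \<Rightarrow> observation list \<Rightarrow> bool"

definition accepted :: "decision_rule \<Rightarrow> real \<Rightarrow> observation list \<Rightarrow> nat set" where
  "accepted A r os = {t. t < length os \<and> A r (take (Suc t) os)}"

definition ALG :: "decision_rule \<Rightarrow> real \<Rightarrow> observation list \<Rightarrow> real" where
  "ALG A r os = (\<Sum>t\<in>accepted A r os. fst (os ! t))"

text \<open>A randomized algorithm is a decision rule together with the distribution \<open>R\<close> of its seed.
  The second condition says that the accepted set is always independent; the last one, that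
  decisions are measurable in the seed and the weights, makes expectations meaningful.\<close>

definition online_algorithm :: "real measure \<Rightarrow> decision_rule \<Rightarrow> bool" where
  "online_algorithm R A \<longleftrightarrow>
     prob_space R \<and> sets R = sets borel \<and>
     (\<forall>r os. \<forall>t\<in>accepted A r os. snd (os ! t) \<inter> {..<t} \<inter> accepted A r os = {}) \<and>
     (\<forall>k (N :: nat \<Rightarrow> nat set).
        Measurable.pred (borel \<Otimes>\<^sub>M (\<Pi>\<^sub>M i\<in>{..<k}. borel))
          (\<lambda>(r, x). A r (map (\<lambda>i. (x i, N i)) [0..<k])))"

definition secretary_instance :: "nat \<Rightarrow> (nat \<Rightarrow> nat \<Rightarrow> bool) \<Rightarrow> (nat \<Rightarrow> real) \<Rightarrow> bool" where
  "secretary_instance m E w \<longleftrightarrow> interval_graph {..<m} E \<and> (\<forall>v<m. 0 \<le> w v)"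

definition secretary_ALG ::
    "nat \<Rightarrow> (nat \<Rightarrow> nat \<Rightarrow> bool) \<Rightarrow> (nat \<Rightarrow> real) \<Rightarrow> real measure \<Rightarrow> decision_rule \<Rightarrow> real" where
  "secretary_ALG m E w R A =
     measure_pmf.expectation (pmf_of_set {\<pi>. \<pi> permutes {..<m}})
       (\<lambda>\<pi>. \<integral>r. ALG A r (observations m E w \<pi>) \<partial>R)"

definition prophet_instance ::
    "nat \<Rightarrow> (nat \<Rightarrow> nat \<Rightarrow> bool) \<Rightarrow> (nat \<Rightarrow> real measure) \<Rightarrow> (nat \<Rightarrow> nat) \<Rightarrow> bool" where
  "prophet_instance m E D \<pi> \<longleftrightarrow>
     interval_graph {..<m} E \<and> \<pi> permutes {..<m} \<and>
     (\<forall>v<m. prob_space (D v) \<and> sets (D v) = sets borel \<and>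
            (AE x in D v. 0 \<le> x) \<and> integrable (D v) (\<lambda>x. x))"

definition prophet_OPT :: "nat \<Rightarrow> (nat \<Rightarrow> nat \<Rightarrow> bool) \<Rightarrow> (nat \<Rightarrow> real measure) \<Rightarrow> real" where
  "prophet_OPT m E D = (\<integral>w. OPT {..<m} E w \<partial>(\<Pi>\<^sub>M v\<in>{..<m}. D v))"

definition prophet_ALG ::
    "nat \<Rightarrow> (nat \<Rightarrow> nat \<Rightarrow> bool) \<Rightarrow> (nat \<Rightarrow> real measure) \<Rightarrow> (nat \<Rightarrow> nat) \<Rightarrow>
     real measure \<Rightarrow> decision_rule \<Rightarrow> real" where
  "prophet_ALG m E D \<pi> R A =
     (\<integral>(r, w). ALG A r (observations m E w \<pi>) \<partial>(R \<Otimes>\<^sub>M (\<Pi>\<^sub>M v\<in>{..<m}. D v)))"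

end

theory Submission
  imports Defs "HOL-Library.Sublist" "HOL-Real_Asymp.Real_Asymp"
begin

text \<open>
  The intervals form the \<open>d\<close>-ary tree of depth \<open>h\<close> with \<open>d = h\<^sup>2\<close>, a node being adjacent to its
  ancestors and descendants. A node weighs the number of leaves below it, and only about one node in
  \<open>h\<close> is worth something. The optimum takes the topmost valuable nodes and covers a constant fraction
  of the leaves, since every leaf has \<open>h\<close> ancestors. An online algorithm that accepts a node loses
  all its ancestors, and it cannot tell which of them are valuable.

  Prophets: every weight is nonzero with probability \<open>1 / h\<close>, and nodes arrive bottom-up. Before the
  algorithm accepts something below \<open>u\<close>, it is willing to do so for only about \<open>h\<close> nodes, each of
  weight at most \<open>w u / d\<close>. Hence, up to lower order terms, it is willing to accept only an antichain,
  of which a fraction \<open>1 / h\<close> is valuable.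

  Secretaries: every inner node has exactly \<open>h\<close> randomly placed children in the instance and the others
  are absent. An accepted node with an ancestor that the algorithm would also accept is the first
  one accepted below that ancestor, so such nodes weigh little. Otherwise the accepted node is the
  topmost node on its path that the algorithm would accept, which the history determines. Given the
  history, this node is present with probability at most \<open>1 / (h - 1)\<close> and, if so, the next of the \<open>k\<close>
  remaining ones with probability \<open>1 / k\<close>. Summing \<open>1 / k\<close> until a fraction \<open>1 / h\<close> of the nodes
  remains gives a factor \<open>ln h\<close>; the late nodes weigh only a fraction \<open>1 / h\<close> of everything.
  So the ratio is \<open>O(ln h / h)\<close> in both cases, with \<open>ln n\<close> of order \<open>h ln h\<close>.
\<close>

subsection \<open>Prefix trees as interval graphs\<close>

definition comparable :: "nat list \<Rightarrow> nat list \<Rightarrow> bool" where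
  "comparable x y \<longleftrightarrow> strict_prefix x y \<or> strict_prefix y x"

lemma prefixes_comparable:
  "prefix u l \<Longrightarrow> prefix v l \<Longrightarrow> u = v \<or> comparable u v"
  by (metis comparable_def prefix_same_cases strict_prefixI)

text \<open>The letters are base-\<open>d\<close> digits after the point, the first letter being the
  most significant one.\<close>

fun left_end :: "nat \<Rightarrow> nat list \<Rightarrow> real" where
  "left_end d [] = 0"
| "left_end d (a # xs) = (real a + left_end d xs) / real d"

text \<open>Half-open intervals keep neighbouring siblings, whose closures share an endpoint, from
  meeting.\<close>

definition cell :: "nat \<Rightarrow> nat list \<Rightarrow> real set" where
  "cell d xs = {left_end d xs ..< left_end d xs + 1 / real d ^ length xs}"

lemma cell_bounds:
  assumes "set xs \<subseteq> {..<d}"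
  shows "0 \<le> left_end d xs \<and> left_end d xs + 1 / real d ^ length xs \<le> 1"
  using assms
proof (induction xs)
  case (Cons a xs)
  then have d: "real a + 1 \<le> real d" "real d > 0"
    and IH: "0 \<le> left_end d xs" "left_end d xs + 1 / real d ^ length xs \<le> 1" by auto
  have "left_end d (a # xs) + 1 / real d ^ length (a # xs)
      = (real a + (left_end d xs + 1 / real d ^ length xs)) / real d"
    using d by (simp add: field_simps)
  also have "\<dots> \<le> 1" using d IH by (simp add: divide_le_eq)
  finally show ?case using d IH by simp
qed auto

lemma cell_Cons_iff:
  assumes "d > 0"
  shows "z \<in> cell d (a # xs) \<longleftrightarrow> real d * z - real a \<in> cell d xs"
proof -
  have "left_end d (a # xs) + 1 / real d ^ length (a # xs)
      = (real a + (left_end d xs + 1 / real d ^ length xs)) / real d"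
    using assms by (simp add: add_divide_distrib)
  moreover have "(real a + c) / real d \<le> z \<longleftrightarrow> c \<le> real d * z - real a"
    "z < (real a + c) / real d \<longleftrightarrow> real d * z - real a < c" for c
    using assms by (auto simp: field_simps)
  ultimately show ?thesis unfolding cell_def by (simp del: length_Cons power_Suc)
qed

text \<open>Multiplying by \<open>d\<close> and subtracting a common first letter reduces to the
  remaining words. Different first letters place the cells in disjoint intervals
  \<open>[a / d, (a + 1) / d)\<close>.\<close>

lemma cells_meet_iff:
  assumes "set xs \<subseteq> {..<d}" "set ys \<subseteq> {..<d}"
  shows "cell d xs \<inter> cell d ys \<noteq> {} \<longleftrightarrow> prefix xs ys \<or> prefix ys xs"
  using assms
proof (induction xs arbitrary: ys)
  case Nil
  then have "left_end d ys \<in> cell d [] \<inter> cell d ys"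
    using cell_bounds[of ys d]
    by (cases "d = 0") (auto simp: cell_def intro: less_le_trans[of _ "left_end d ys + 1 / real d ^ length ys"])
  then show ?case by auto
next
  case (Cons a xs)
  then have d: "d > 0" by auto
  show ?case
  proof (cases ys)
    case Nil
    then have "left_end d (a # xs) \<in> cell d (a # xs) \<inter> cell d []"
      using cell_bounds[of "a # xs" d] Cons.prems d
      by (auto simp: cell_def simp del: left_end.simps(2)
          intro: less_le_trans[of _ "left_end d (a # xs) + 1 / real d ^ length (a # xs)"])
    then show ?thesis using Nil by auto
  next
    case (Cons b zs)
    have b: "set zs \<subseteq> {..<d}" using Cons \<open>set ys \<subseteq> _\<close> by auto
    have "cell d (a # xs) \<inter> cell d (b # zs) \<noteq> {} \<longleftrightarrow> a = b \<and> cell d xs \<inter> cell d zs \<noteq> {}"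
    proof
      assume "cell d (a # xs) \<inter> cell d (b # zs) \<noteq> {}"
      then obtain z where z: "real d * z - real a \<in> cell d xs" "real d * z - real b \<in> cell d zs"
        using cell_Cons_iff[OF d] by blast
      have "0 \<le> real d * z - real a" "real d * z - real a < 1"
        using z(1) cell_bounds[of xs d] Cons.prems(1) by (auto simp: cell_def)
      moreover have "0 \<le> real d * z - real b" "real d * z - real b < 1"
        using z(2) cell_bounds[of zs d] b by (auto simp: cell_def)
      ultimately have "a = b" by linarith
      then show "a = b \<and> cell d xs \<inter> cell d zs \<noteq> {}" using z by auto
    next
      assume R: "a = b \<and> cell d xs \<inter> cell d zs \<noteq> {}"
      then obtain z where "z \<in> cell d xs" "z \<in> cell d zs" by auto
      then have "(z + real a) / real d \<in> cell d (a # xs) \<inter> cell d (b # zs)"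
        using R d by (simp add: cell_Cons_iff)
      then show "cell d (a # xs) \<inter> cell d (b # zs) \<noteq> {}" by blast
    qed
    then show ?thesis using Cons.IH[of zs] Cons.prems b Cons by auto
  qed
qed

lemma interval_graph_comparable:
  assumes e: "inj_on e {..<m}" "\<And>v. v < m \<Longrightarrow> set (e v) \<subseteq> {..<d}" and "d > 0"
  shows "interval_graph {..<m} (\<lambda>u v. comparable (e u) (e v))"
  unfolding interval_graph_def
proof (intro conjI exI[of _ "\<lambda>v. cell d (e v)"] ballI)
  fix v assume "v \<in> {..<m}"
  show "is_interval (cell d (e v))"
    by (simp add: cell_def is_interval_co)
  show "cell d (e v) \<noteq> {}" using \<open>d > 0\<close> by (simp add: cell_def)
next
  fix u v assume "u \<in> {..<m}" "v \<in> {..<m}"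
  then show "comparable (e u) (e v) \<longleftrightarrow> u \<noteq> v \<and> cell d (e u) \<inter> cell d (e v) \<noteq> {}"
    using cells_meet_iff[of "e u" d "e v"] e
    by (auto simp: comparable_def strict_prefix_def dest: inj_onD)
qed simp

section \<open>Node weights and leaf counts in the \<open>d\<close>-ary tree\<close>

locale interval_tree =
  fixes h d :: nat
  assumes h2: "2 \<le> h" and d_eq: "d = h * h"
begin

definition words :: "nat \<Rightarrow> nat list set" where
  "words n = {xs. set xs \<subseteq> {..<d} \<and> length xs = n}"

text \<open>The root is left out, so each leaf has exactly \<open>h\<close> prefixes among the
  nodes, itself included.\<close>

definition nodes :: "nat list set" where
  "nodes = (\<Union>i\<in>{1..h}. words i)"

definition wt :: "nat list \<Rightarrow> real" where
  "wt v = real d ^ (h - length v)"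

abbreviation leaves :: real where
  "leaves \<equiv> real d ^ h"

lemma d_pos: "d > 0" and h_less_d: "h < d"
  using h2 by (auto simp: d_eq)

lemma finite_words [simp]: "finite (words n)"
  and card_words: "card (words n) = d ^ n"
  using finite_lists_length_eq[of "{..<d}" n] card_lists_length_eq[of "{..<d}" n]
  by (auto simp: words_def)

lemma finite_nodes [simp]: "finite nodes"
  by (simp add: nodes_def)

lemma nodes_iff: "v \<in> nodes \<longleftrightarrow> set v \<subseteq> {..<d} \<and> v \<noteq> [] \<and> length v \<le> h"
  by (cases v) (auto simp: nodes_def words_def)

lemma wt_pos: "wt v > 0"
  using d_pos by (simp add: wt_def)

lemma wt_eq_card:
  assumes "set v \<subseteq> {..<d}" "length v \<le> h"
  shows "wt v = real (card {l \<in> words h. prefix v l})"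
proof -
  have "{l \<in> words h. prefix v l} = (@) v ` words (h - length v)"
    using assms by (auto simp: words_def prefix_def)
  then have "card {l \<in> words h. prefix v l} = d ^ (h - length v)"
    by (simp add: card_image card_words inj_on_def)
  then show ?thesis by (simp add: wt_def)
qed

text \<open>Each level down costs a factor \<open>d\<close>, so a node charged to a proper ancestor
  uses at most a fraction \<open>1 / d\<close> of that ancestor's weight.\<close>

lemma wt_strict_prefix:
  assumes "strict_prefix u v" "length v \<le> h"
  shows "wt v \<le> wt u / real d"
proof -
  have l: "length u < length v" using assms by (simp add: prefix_length_less)
  have "wt v * real d = real d ^ Suc (h - length v)" by (simp add: wt_def)
  also have "\<dots> \<le> real d ^ (h - length u)"
    using l assms(2) d_pos by (intro power_increasing) auto
  finally show ?thesis using d_pos by (simp add: wt_def field_simps)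
qed

text \<open>Each of the \<open>h\<close> levels covers every leaf exactly once and so has total
  weight \<open>leaves\<close>.\<close>

lemma sum_wt_nodes: "(\<Sum>v\<in>nodes. wt v) = real h * leaves"
proof -
  have "(\<Sum>v\<in>nodes. wt v) = (\<Sum>i\<in>{1..h}. \<Sum>v\<in>words i. wt v)"
    unfolding nodes_def by (rule sum.UNION_disjoint) (simp_all, auto simp: words_def)
  also have "\<dots> = (\<Sum>i\<in>{1..h}. leaves)"
  proof (rule sum.cong[OF refl])
    fix i assume i: "i \<in> {1..h}"
    have "(\<Sum>v\<in>words i. wt v) = (\<Sum>v\<in>words i. real d ^ (h - i))"
      by (rule sum.cong) (auto simp: words_def wt_def)
    also have "\<dots> = leaves"
      using i by (simp add: card_words flip: power_add)
    finally show "(\<Sum>v\<in>words i. wt v) = leaves" .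
  qed
  finally show ?thesis by simp
qed

text \<open>Double counting of the pairs of a node of \<open>S\<close> and a leaf below it.\<close>

lemma sum_wt_leaves:
  assumes "S \<subseteq> nodes"
  shows "(\<Sum>v\<in>S. wt v) = (\<Sum>l\<in>words h. real (card {v\<in>S. prefix v l}))"
proof -
  have fS: "finite S" using assms finite_subset finite_nodes by blast
  have "(\<Sum>v\<in>S. wt v) = (\<Sum>v\<in>S. \<Sum>l\<in>words h. if prefix v l then 1 else 0)"
    using assms by (intro sum.cong refl) (auto simp: wt_eq_card nodes_iff sum.If_cases Int_def)
  also have "\<dots> = (\<Sum>l\<in>words h. \<Sum>v\<in>S. if prefix v l then 1 else 0)"
    by (rule sum.swap)
  also have "\<dots> = (\<Sum>l\<in>words h. real (card {v\<in>S. prefix v l}))"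
    using fS by (intro sum.cong refl) (auto simp: sum.If_cases Int_def)
  finally show ?thesis .
qed

text \<open>The prefixes of one leaf are pairwise comparable, so an antichain contains at most one
  of them.\<close>

lemma antichain_wt_le:
  assumes "S \<subseteq> nodes" "\<And>u v. u \<in> S \<Longrightarrow> v \<in> S \<Longrightarrow> \<not> comparable u v"
  shows "(\<Sum>v\<in>S. wt v) \<le> leaves"
proof -
  have "card {v\<in>S. prefix v l} \<le> 1" for l
  proof -
    have "finite S" using assms finite_subset finite_nodes by blast
    then show ?thesis
      using assms(2) prefixes_comparable[of _ l] by (simp add: card_le_Suc0_iff_eq) blast
  qed
  then have "(\<Sum>v\<in>S. wt v) \<le> (\<Sum>l\<in>words h. 1)"
    unfolding sum_wt_leaves[OF assms(1)] by (intro sum_mono) simp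
  then show ?thesis by (simp add: card_words)
qed

text \<open>The shortest prefix of a covered leaf that lies in \<open>S\<close> has nothing of
  \<open>S\<close> above it, so passing to the topmost nodes uncovers no leaf.\<close>

lemma roots_wt_ge:
  assumes "S \<subseteq> nodes"
  shows "(\<Sum>v\<in>{v\<in>S. \<forall>u\<in>S. \<not> strict_prefix u v}. wt v)
    \<ge> real (card {l\<in>words h. \<exists>v\<in>S. prefix v l})"
proof -
  let ?T = "{v\<in>S. \<forall>u\<in>S. \<not> strict_prefix u v}"
  have fS: "finite S" using assms finite_subset finite_nodes by blast
  have *: "card {v\<in>?T. prefix v l} \<ge> 1" if l: "\<exists>v\<in>S. prefix v l" for l
  proof -
    have "\<exists>v\<in>S. prefix v l \<and> (\<forall>u\<in>S. prefix u l \<longrightarrow> length v \<le> length u)"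
      using l ex_has_least_nat[of "\<lambda>v. v \<in> S \<and> prefix v l" _ length] by blast
    then obtain v where v: "v \<in> S" "prefix v l" "\<And>u. u \<in> S \<Longrightarrow> prefix u l \<Longrightarrow> length v \<le> length u"
      by auto
    have "\<not> strict_prefix u v" if "u \<in> S" for u
      using v that prefix_length_less[of u v] prefix_order.less_le_trans[of u v l] by fastforce
    then have "v \<in> {v\<in>?T. prefix v l}" using v by simp
    then have "{v\<in>?T. prefix v l} \<noteq> {}" by blast
    then show ?thesis using fS by (simp add: Suc_le_eq card_gt_0_iff)
  qed
  have "real (card {l\<in>words h. \<exists>v\<in>S. prefix v l}) = (\<Sum>l\<in>words h. if \<exists>v\<in>S. prefix v l then 1 else 0)"
    by (auto simp: sum.If_cases Int_def)
  also have "\<dots> \<le> (\<Sum>l\<in>words h. real (card {v\<in>?T. prefix v l}))"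
    using * by (intro sum_mono) force
  also have "\<dots> = (\<Sum>v\<in>?T. wt v)"
    using assms by (intro sum_wt_leaves[symmetric]) auto
  finally show ?thesis .
qed

end

subsection \<open>Prophets\<close>

definition accepted_times :: "(observation list \<Rightarrow> bool) \<Rightarrow> observation list \<Rightarrow> nat set" where
  "accepted_times a os = {t. t < length os \<and> a (take (Suc t) os)}"

text \<open>The seed is fixed here: all counting concerns deterministic rules, and the seed is
  integrated out at the end. Quantifying over all lists \<open>os\<close> includes hypothetical
  continuations of a history.\<close>

definition feasible_rule :: "(observation list \<Rightarrow> bool) \<Rightarrow> bool" where
  "feasible_rule a \<longleftrightarrow>
     (\<forall>os. \<forall>t\<in>accepted_times a os. snd (os ! t) \<inter> {..<t} \<inter> accepted_times a os = {})"

lemma online_algorithm_feasible: "online_algorithm R A \<Longrightarrow> feasible_rule (A r)"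
  unfolding online_algorithm_def feasible_rule_def accepted_def accepted_times_def by blast

lemma sum_if_filter:
  "finite S \<Longrightarrow> (\<Sum>x\<in>S. if P x then f x else 0) = (\<Sum>x\<in>{x\<in>S. P x}. f x)"
  by (simp add: sum.inter_filter)

lemma sum_if_const:
  "finite S \<Longrightarrow> (\<Sum>x\<in>S. if P x then c else 0) = real (card {x\<in>S. P x}) * c"
  by (simp add: sum_if_filter)

text \<open>Meant for a hypothetical next arrival \<open>(c, N)\<close>: a rule that would accept it
  cannot have accepted any earlier neighbour listed in \<open>N\<close>.\<close>

lemma feasible_rule_blocks:
  assumes "feasible_rule a" "a (map g [0..<t] @ [(c, N)])" "s < t" "s \<in> N"
  shows "\<not> a (map g [0..<Suc s])"
proof
  assume s: "a (map g [0..<Suc s])"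
  let ?os = "map g [0..<t] @ [(c, N)]"
  have "take (Suc s) ?os = map g [0..<Suc s]"
    using assms(3) by (simp add: take_map del: upt_Suc)
  then have "s \<in> accepted_times a ?os" "t \<in> accepted_times a ?os"
    using assms s by (auto simp: accepted_times_def simp del: upt_Suc)
  moreover have "snd (?os ! t) = N" by (simp add: nth_append)
  ultimately have "s \<in> snd (?os ! t) \<inter> {..<t} \<inter> accepted_times a ?os"
    using assms by auto
  then show False
    using assms(1) \<open>t \<in> _\<close> unfolding feasible_rule_def by blast
qed

lemma ALG_map_upt:
  "ALG A r (map g [0..<m]) = (\<Sum>t<m. if A r (map g [0..<Suc t]) then fst (g t) else 0)"
proof -
  have *: "accepted A r (map g [0..<m]) = {t\<in>{..<m}. A r (map g [0..<Suc t])}"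
    by (auto simp: accepted_def take_map simp del: upt_Suc)
  show ?thesis
    unfolding ALG_def * sum_if_filter[OF finite_lessThan, symmetric]
    by (intro sum.cong) (auto simp del: upt_Suc)
qed

text \<open>An integer form of \<open>(1 - 1 / h) ^ h \<le> 1 / 2\<close>, by Bernoulli's
  inequality. It bounds the share of leaves without a valuable or present prefix in both
  models.\<close>

lemma two_power_le:
  assumes "2 \<le> (h::nat)"
  shows "2 * (h - 1) ^ h \<le> h ^ h"
proof -
  have h: "real h - 1 > 0" using assms by simp
  have "2 \<le> 1 + real h * (1 / (real h - 1))"
    using h by (simp add: field_simps)
  also have "\<dots> \<le> (1 + 1 / (real h - 1)) ^ h"
    using h by (intro Bernoulli_inequality) (simp add: field_simps)
  also have "1 + 1 / (real h - 1) = real h / (real h - 1)"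
    using h by (simp add: field_simps)
  finally have "2 * (real h - 1) ^ h \<le> real h ^ h"
    using h by (simp add: power_divide field_simps)
  then have "real (2 * (h - 1) ^ h) \<le> real (h ^ h)"
    using assms by (simp add: of_nat_diff)
  then show ?thesis by (simp only: of_nat_le_iff)
qed

lemma OPT_ge:
  assumes "finite V" "independent_set V E S"
  shows "(\<Sum>v\<in>S. w v) \<le> OPT V E w"
proof -
  have "finite {S. independent_set V E S}"
    by (rule finite_subset[of _ "Pow V"]) (auto simp: independent_set_def assms)
  then show ?thesis
    unfolding OPT_def using assms(2) by (intro Max_ge) (auto simp: Setcompr_eq_image)
qed

lemma borel_measurable_OPT:
  assumes "finite V"
  shows "OPT V E \<in> borel_measurable (\<Pi>\<^sub>M v\<in>V. borel)"
proof -
  have "finite {S. independent_set V E S}"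
    by (rule finite_subset[of _ "Pow V"]) (auto simp: independent_set_def assms)
  then have "(\<lambda>w. Max ((\<lambda>S. \<Sum>v\<in>S. w v) ` {S. independent_set V E S}))
      \<in> borel_measurable (\<Pi>\<^sub>M v\<in>V. (borel :: real measure))"
    by (intro borel_measurable_Max borel_measurable_sum measurable_component_singleton)
       (auto simp: independent_set_def)
  moreover have "OPT V E = (\<lambda>w. Max ((\<lambda>S. \<Sum>v\<in>S. w v) ` {S. independent_set V E S}))"
    unfolding OPT_def[abs_def] by (simp add: setcompr_eq_image)
  ultimately show ?thesis by simp
qed

text \<open>Reduces expectations over independent weights to finite counts. Both measures agree on
  boxes, where the number of admissible functions is a product.\<close>

lemma PiM_distr_pmf_of_set:
  fixes f :: "'i \<Rightarrow> 'k \<Rightarrow> real"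
  assumes I: "finite I" and K: "finite K" "K \<noteq> {}"
  shows "(\<Pi>\<^sub>M i\<in>I. distr (measure_pmf (pmf_of_set K)) borel (f i))
    = distr (measure_pmf (pmf_of_set (\<Pi>\<^sub>E i\<in>I. K))) (\<Pi>\<^sub>M i\<in>I. borel) (\<lambda>x. \<lambda>i\<in>I. f i (x i))"
    (is "PiM I ?M = ?P")
proof -
  have "prob_space (?M i)" for i
    by (rule measure_pmf.prob_space_distr) simp
  then interpret product_sigma_finite ?M
    by (simp add: product_sigma_finite_def prob_space_imp_sigma_finite)
  have ne: "(\<Pi>\<^sub>E i\<in>I. K) \<noteq> {}" "finite (\<Pi>\<^sub>E i\<in>I. K)"
    using I K by (auto simp: PiE_eq_empty_iff intro: finite_PiE)
  have F: "(\<lambda>x. \<lambda>i\<in>I. f i (x i)) \<in> measure_pmf (pmf_of_set (\<Pi>\<^sub>E i\<in>I. K)) \<rightarrow>\<^sub>M (\<Pi>\<^sub>M i\<in>I. borel)"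
    by (auto simp: space_PiM)
  have "?P = PiM I ?M"
  proof (rule PiM_eqI[OF I])
    show "sets ?P = sets (PiM I ?M)"
      by (simp, intro sets_PiM_cong) auto
    fix A assume A: "\<And>i. i \<in> I \<Longrightarrow> A i \<in> sets (?M i)"
    have pre: "(\<Pi>\<^sub>E i\<in>I. K) \<inter> (\<lambda>x. \<lambda>i\<in>I. f i (x i)) -` (Pi\<^sub>E I A) = (\<Pi>\<^sub>E i\<in>I. K \<inter> f i -` A i)"
      by (auto simp: PiE_iff)
    have "emeasure ?P (Pi\<^sub>E I A)
        = emeasure (measure_pmf (pmf_of_set (\<Pi>\<^sub>E i\<in>I. K))) ((\<lambda>x. \<lambda>i\<in>I. f i (x i)) -` (Pi\<^sub>E I A))"
      using A I by (subst emeasure_distr[OF F]) (auto intro!: sets_PiM_I_finite)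
    also have "\<dots> = ennreal (real (card (\<Pi>\<^sub>E i\<in>I. K \<inter> f i -` A i)) / real (card (\<Pi>\<^sub>E i\<in>I. K)))"
      using ne by (simp add: measure_pmf.emeasure_eq_measure measure_pmf_of_set pre)
    also have "\<dots> = ennreal (\<Prod>i\<in>I. real (card (K \<inter> f i -` A i)) / real (card K))"
      using I by (simp add: card_PiE prod_dividef)
    also have "\<dots> = (\<Prod>i\<in>I. ennreal (real (card (K \<inter> f i -` A i)) / real (card K)))"
      by (rule prod_ennreal[symmetric]) simp
    also have "\<dots> = (\<Prod>i\<in>I. emeasure (?M i) (A i))"
    proof (rule prod.cong[OF refl])
      fix i assume i: "i \<in> I"
      show "ennreal (real (card (K \<inter> f i -` A i)) / real (card K)) = emeasure (?M i) (A i)"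
        using A[OF i] K
        by (subst emeasure_distr) (auto simp: measure_pmf.emeasure_eq_measure measure_pmf_of_set)
    qed
    finally show "emeasure ?P (Pi\<^sub>E I A) = (\<Prod>i\<in>I. emeasure (?M i) (A i))" .
  qed
  then show ?thesis by simp
qed

text \<open>Independence as counting: an event that ignores coordinate \<open>v\<close> is
  independent of \<open>x v = 0\<close>, which has probability \<open>1 / h\<close>. Overwriting the
  coordinate gives the bijection.\<close>

lemma card_coordinate_zero:
  assumes "v < m" "0 < (h::nat)" and Q: "\<And>x k. Q (x(v := k)) \<longleftrightarrow> Q x"
  shows "h * card {x \<in> {..<m} \<rightarrow>\<^sub>E {..<h}. x v = 0 \<and> Q x} = card {x \<in> {..<m} \<rightarrow>\<^sub>E {..<h}. Q x}"
proof -
  have "bij_betw (\<lambda>(x, k). x(v := k)) ({x \<in> {..<m} \<rightarrow>\<^sub>E {..<h}. x v = 0 \<and> Q x} \<times> {..<h})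
      {x \<in> {..<m} \<rightarrow>\<^sub>E {..<h}. Q x}"
    by (rule bij_betw_byWitness[where f' = "\<lambda>x. (x(v := 0), x v)"])
       (use assms in \<open>auto simp: PiE_iff extensional_def fun_upd_idem\<close>)
  from bij_betw_same_card[OF this] show ?thesis
    by (simp add: card_cartesian_product mult.commute)
qed

section \<open>The prophet instance with bottom-up arrivals\<close>

locale bottom_up_tree = interval_tree +
  fixes m :: nat and e :: "nat \<Rightarrow> nat list"
  assumes bij: "bij_betw e {..<m} nodes"
    and bottom_up: "\<And>i j. i \<le> j \<Longrightarrow> j < m \<Longrightarrow> length (e j) \<le> length (e i)"
begin

definition adj :: "nat \<Rightarrow> nat \<Rightarrow> bool" where
  "adj u v \<longleftrightarrow> comparable (e u) (e v)"

text \<open>Every node draws one of \<open>h\<close> equally likely values, and \<open>0\<close>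
  will mean a nonzero weight. Probabilities thus become counts of outcomes.\<close>

definition outcomes :: "(nat \<Rightarrow> nat) set" where
  "outcomes = {..<m} \<rightarrow>\<^sub>E {..<h}"

definition payoff :: "nat \<Rightarrow> nat \<Rightarrow> real" where
  "payoff v k = (if k = 0 then wt (e v) else 0)"

definition node_dist :: "nat \<Rightarrow> real measure" where
  "node_dist v = distr (measure_pmf (pmf_of_set {..<h})) borel (payoff v)"

definition obs :: "(nat \<Rightarrow> nat) \<Rightarrow> nat \<Rightarrow> observation" where
  "obs x t = (payoff t (x t), {s. s < t \<and> adj s t})"

text \<open>Whether the node arriving at time \<open>t\<close> would be accepted if its weight turned out nonzero; this does
  not depend on \<open>x t\<close>.\<close>

definition willing :: "(observation list \<Rightarrow> bool) \<Rightarrow> (nat \<Rightarrow> nat) \<Rightarrow> nat \<Rightarrow> bool" where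
  "willing a x t \<longleftrightarrow> a (map (obs x) [0..<t] @ [(wt (e t), {s. s < t \<and> adj s t})])"

lemma e_nodes: "v < m \<Longrightarrow> e v \<in> nodes"
  using bij by (auto dest: bij_betwE)

lemma e_inj: "u < m \<Longrightarrow> v < m \<Longrightarrow> e u = e v \<longleftrightarrow> u = v"
  using bij by (auto simp: bij_betw_def dest: inj_onD)

lemma outcomes_finite: "finite outcomes" and card_outcomes: "card outcomes = h ^ m"
  and outcomes_nonempty: "outcomes \<noteq> {}"
  using h2 by (auto simp: outcomes_def card_PiE PiE_eq_empty_iff lessThan_empty_iff intro!: finite_PiE)

lemma below_earlier:
  assumes "strict_prefix (e u) (e v)" "u < m" "v < m"
  shows "v < u"
  using bottom_up[of u v] prefix_length_less[OF assms(1)] assms by (cases "u \<le> v") auto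

lemma willing_upd:
  assumes "t \<le> v"
  shows "willing a (x(v := k)) t \<longleftrightarrow> willing a x t"
proof -
  have "map (obs (x(v := k))) [0..<t] = map (obs x) [0..<t]"
    using assms by (intro map_cong) (auto simp: obs_def)
  then show ?thesis by (simp only: willing_def)
qed

lemma willing_iff:
  assumes "x t = 0"
  shows "willing a x t \<longleftrightarrow> a (map (obs x) [0..<Suc t])"
  using assms by (simp add: willing_def obs_def payoff_def)

text \<open>Descendants arrive first, so a valuable and willing \<open>v\<close> has been accepted
  by the time \<open>u\<close> arrives and rules \<open>u\<close> out.\<close>

lemma willing_blocked:
  assumes "feasible_rule a" "willing a x u" "strict_prefix (e u) (e v)" "u < m" "v < m" "x v = 0"
  shows "\<not> willing a x v"
proof -
  have "v < u" using below_earlier assms by blast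
  moreover have "v \<in> {s. s < u \<and> adj s u}"
    using assms \<open>v < u\<close> by (auto simp: adj_def comparable_def)
  ultimately have "\<not> a (map (obs x) [0..<Suc v])"
    using feasible_rule_blocks[OF assms(1) assms(2)[unfolded willing_def]] by blast
  then show ?thesis using willing_iff[of x v a] assms by blast
qed

definition gain :: "(observation list \<Rightarrow> bool) \<Rightarrow> (nat \<Rightarrow> nat) \<Rightarrow> real" where
  "gain a x = (\<Sum>v<m. if x v = 0 \<and> willing a x v then wt (e v) else 0)"

lemma ALG_eq_gain: "ALG A r (map (obs x) [0..<m]) = gain (A r) x"
  unfolding ALG_map_upt gain_def
proof (intro sum.cong refl)
  fix t
  show "(if A r (map (obs x) [0..<Suc t]) then fst (obs x t) else 0)
      = (if x t = 0 \<and> willing (A r) x t then wt (e t) else 0)"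
    using willing_iff[of x t "A r"] by (auto simp: obs_def payoff_def)
qed

text \<open>If \<open>u\<close> and a node \<open>v\<close> below it are both willing, then nothing of nonzero weight has been
  accepted below \<open>u\<close>. Being the first acceptance below \<open>u\<close> is a disjoint event for different \<open>v\<close>,
  and each fresh \<open>v\<close> is one with probability \<open>1 / h\<close>.\<close>

definition fresh :: "(observation list \<Rightarrow> bool) \<Rightarrow> nat \<Rightarrow> nat \<Rightarrow> (nat \<Rightarrow> nat) \<Rightarrow> bool" where
  "fresh a u v x \<longleftrightarrow> willing a x v \<and>
     (\<forall>v'<v. strict_prefix (e u) (e v') \<longrightarrow> \<not> (x v' = 0 \<and> willing a x v'))"

text \<open>Willing nodes without a willing proper ancestor form an antichain. Any other is charged
  to a willing ancestor \<open>u\<close>; it is fresh for \<open>u\<close>, since by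
  \<open>willing_blocked\<close> nothing valuable below \<open>u\<close> was accepted.\<close>

lemma willing_sum_le:
  assumes a: "feasible_rule a"
  shows "(\<Sum>v<m. if willing a x v then wt (e v) else 0)
    \<le> leaves + (\<Sum>u<m. \<Sum>v<m. if strict_prefix (e u) (e v) \<and> fresh a u v x then wt (e v) else 0)"
proof -
  let ?T = "{v\<in>{..<m}. willing a x v \<and> (\<forall>u<m. willing a x u \<longrightarrow> \<not> strict_prefix (e u) (e v))}"
  let ?g = "\<lambda>u v. if strict_prefix (e u) (e v) \<and> fresh a u v x then wt (e v) else 0"
  have g0: "0 \<le> ?g u v" for u v using wt_pos[of "e v"] by simp
  have "(if willing a x v then wt (e v) else 0) \<le> (if v \<in> ?T then wt (e v) else 0) + (\<Sum>u<m. ?g u v)"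
    if v: "v < m" for v
  proof (cases "willing a x v \<and> v \<notin> ?T")
    case True
    then obtain u where u: "u < m" "willing a x u" "strict_prefix (e u) (e v)" using v by auto
    have "fresh a u v x"
      unfolding fresh_def using True u v willing_blocked[OF a u(2) _ u(1)] by (meson less_trans)
    then have "wt (e v) = ?g u v" using u by simp
    also have "\<dots> \<le> (\<Sum>u<m. ?g u v)"
      by (rule member_le_sum) (use u g0 in auto)
    finally show ?thesis using True by (simp only: if_True if_False simp_thms add_0)
  next
    case False
    then show ?thesis using sum_nonneg[of "{..<m}" "\<lambda>u. ?g u v"] g0 by auto
  qed
  then have "(\<Sum>v<m. if willing a x v then wt (e v) else 0)
      \<le> (\<Sum>v<m. (if v \<in> ?T then wt (e v) else 0) + (\<Sum>u<m. ?g u v))"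
    by (intro sum_mono) auto
  also have "\<dots> = (\<Sum>v\<in>?T. wt (e v)) + (\<Sum>u<m. \<Sum>v<m. ?g u v)"
    unfolding sum.distrib
    by (intro arg_cong2[of _ _ _ _ "(+)"] sum.swap) (simp add: sum_if_filter)
  also have "(\<Sum>v\<in>?T. wt (e v)) = (\<Sum>z\<in>e ` ?T. wt z)"
    by (subst sum.reindex) (auto simp: inj_on_def e_inj)
  also have "\<dots> \<le> leaves"
    by (rule antichain_wt_le) (auto simp: e_nodes comparable_def)
  finally show ?thesis by simp
qed

lemma sum_fresh_le:
  assumes u: "u < m"
  shows "(\<Sum>x\<in>outcomes. \<Sum>v<m. if strict_prefix (e u) (e v) \<and> fresh a u v x then wt (e v) else 0)
    \<le> wt (e u) / real d * (real h * real (card outcomes))"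
proof -
  let ?B = "{v\<in>{..<m}. strict_prefix (e u) (e v)}"
  let ?F = "\<lambda>v. {x\<in>outcomes. x v = 0 \<and> fresh a u v x}"
  have "(\<Sum>x\<in>outcomes. \<Sum>v<m. if strict_prefix (e u) (e v) \<and> fresh a u v x then wt (e v) else 0)
      = (\<Sum>v<m. \<Sum>x\<in>outcomes. if strict_prefix (e u) (e v) \<and> fresh a u v x then wt (e v) else 0)"
    by (rule sum.swap)
  also have "\<dots> = (\<Sum>v\<in>?B. \<Sum>x\<in>outcomes. if fresh a u v x then wt (e v) else 0)"
    unfolding sum_if_filter[OF finite_lessThan, symmetric] by (intro sum.cong) auto
  also have "\<dots> = (\<Sum>v\<in>?B. wt (e v) * (real h * real (card (?F v))))"
  proof (rule sum.cong[OF refl])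
    fix v assume v: "v \<in> ?B"
    have "h * card (?F v) = card {x\<in>outcomes. fresh a u v x}"
      unfolding outcomes_def
    proof (rule card_coordinate_zero)
      \<comment> \<open>Freshness looks only at the coordinates before \<open>v\<close>, so it is
        independent of the value drawn at \<open>v\<close>.\<close>
      show "fresh a u v (x(v := k)) \<longleftrightarrow> fresh a u v x" for x k
        unfolding fresh_def by (simp add: willing_upd)
    qed (use v h2 in auto)
    then have "real h * real (card (?F v)) = real (card {x\<in>outcomes. fresh a u v x})"
      by (simp only: of_nat_mult[symmetric])
    then show "(\<Sum>x\<in>outcomes. if fresh a u v x then wt (e v) else 0)
        = wt (e v) * (real h * real (card (?F v)))"
      using outcomes_finite by (simp add: sum_if_const)
  qed
  also have "\<dots> \<le> (\<Sum>v\<in>?B. wt (e u) / real d * (real h * real (card (?F v))))"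
    using e_nodes by (intro sum_mono mult_right_mono wt_strict_prefix) (auto simp: nodes_iff)
  also have "\<dots> = wt (e u) / real d * (real h * real (\<Sum>v\<in>?B. card (?F v)))"
    by (simp add: sum_distrib_left)
  \<comment> \<open>Together with \<open>x v = 0\<close>, freshness makes \<open>v\<close> the first
    accepted node below \<open>u\<close>, which happens for at most one \<open>v\<close> per
    outcome.\<close>
  also have "(\<Sum>v\<in>?B. card (?F v)) = card (\<Union>v\<in>?B. ?F v)"
  proof (rule card_UN_disjoint[symmetric])
    show "\<forall>v\<in>?B. \<forall>v'\<in>?B. v \<noteq> v' \<longrightarrow> ?F v \<inter> ?F v' = {}"
    proof (intro ballI impI)
      fix v v' assume B: "v \<in> ?B" "v' \<in> ?B" "v \<noteq> v'"
      then have "v < v' \<or> v' < v" by auto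
      then show "?F v \<inter> ?F v' = {}" using B unfolding fresh_def by auto
    qed
  qed (use outcomes_finite in auto)
  also have "wt (e u) / real d * (real h * real (card (\<Union>v\<in>?B. ?F v)))
      \<le> wt (e u) / real d * (real h * real (card outcomes))"
    using wt_pos[of "e u"] outcomes_finite
    by (intro mult_left_mono of_nat_mono card_mono) auto
  finally show ?thesis .
qed

text \<open>Willingness is settled before the value is drawn, so the gain is on average
  \<open>1 / h\<close> of the willing weight. That weight is at most one antichain plus the charges
  to ancestors.\<close>

lemma sum_gain_le:
  assumes a: "feasible_rule a"
  shows "(\<Sum>x\<in>outcomes. gain a x) \<le> 2 * leaves / real h * real (card outcomes)"
proof -
  have "real h * (\<Sum>x\<in>outcomes. gain a x)
      = (\<Sum>v<m. \<Sum>x\<in>outcomes. real h * (if x v = 0 \<and> willing a x v then wt (e v) else 0))"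
    unfolding gain_def by (subst sum.swap) (simp add: sum_distrib_left)
  also have "\<dots> = (\<Sum>v<m. \<Sum>x\<in>outcomes. if willing a x v then wt (e v) else 0)"
  proof (rule sum.cong[OF refl])
    fix v assume v: "v \<in> {..<m}"
    have "h * card {x\<in>outcomes. x v = 0 \<and> willing a x v} = card {x\<in>outcomes. willing a x v}"
      unfolding outcomes_def
      by (rule card_coordinate_zero) (use v h2 in \<open>auto simp: willing_upd\<close>)
    then have "real h * real (card {x\<in>outcomes. x v = 0 \<and> willing a x v})
        = real (card {x\<in>outcomes. willing a x v})"
      by (simp only: of_nat_mult[symmetric])
    then show "(\<Sum>x\<in>outcomes. real h * (if x v = 0 \<and> willing a x v then wt (e v) else 0))
        = (\<Sum>x\<in>outcomes. if willing a x v then wt (e v) else 0)"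
      using outcomes_finite
      by (simp add: sum_distrib_left[symmetric] sum_if_const)
  qed
  also have "\<dots> = (\<Sum>x\<in>outcomes. \<Sum>v<m. if willing a x v then wt (e v) else 0)"
    by (rule sum.swap)
  also have "\<dots> \<le> (\<Sum>x\<in>outcomes. leaves
      + (\<Sum>u<m. \<Sum>v<m. if strict_prefix (e u) (e v) \<and> fresh a u v x then wt (e v) else 0))"
    by (intro sum_mono willing_sum_le a)
  also have "\<dots> = leaves * real (card outcomes) + (\<Sum>u<m. \<Sum>x\<in>outcomes. \<Sum>v<m.
      if strict_prefix (e u) (e v) \<and> fresh a u v x then wt (e v) else 0)"
    unfolding sum.distrib
    by (intro arg_cong2[of _ _ _ _ "(+)"] sum.swap) simp
  also have "\<dots> \<le> leaves * real (card outcomes)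
      + (\<Sum>u<m. wt (e u) / real d * (real h * real (card outcomes)))"
    by (intro add_left_mono sum_mono sum_fresh_le) auto
  also have "(\<Sum>u<m. wt (e u) / real d * (real h * real (card outcomes)))
      = (\<Sum>u<m. wt (e u)) * (real h * real (card outcomes)) / real d"
    by (simp add: sum_distrib_right sum_divide_distrib)
  also have "(\<Sum>u<m. wt (e u)) = real h * leaves"
    using sum.reindex_bij_betw[OF bij, of wt] sum_wt_nodes by simp
  \<comment> \<open>This is where \<open>d = h * h\<close> enters: it keeps the total charge as
    small as the weight of an antichain.\<close>
  also have "real h * leaves * (real h * real (card outcomes)) / real d = leaves * real (card outcomes)"
    using h2 by (simp add: d_eq)
  finally show ?thesis using h2 by (simp add: field_simps)
qed

text \<open>The \<open>h\<close> prefixes of \<open>l\<close> are independently worthless with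
  probability \<open>1 - 1 / h\<close> each, so all of them are worthless at most half of the
  time.\<close>

lemma uncovered_le:
  assumes l: "l \<in> words h"
  shows "2 * card {x\<in>outcomes. \<forall>v<m. prefix (e v) l \<longrightarrow> x v \<noteq> 0} \<le> card outcomes"
proof -
  let ?P = "{v\<in>{..<m}. prefix (e v) l}"
  have "bij_betw e ?P {z\<in>nodes. prefix z l}"
    using bij by (auto simp: bij_betw_def inj_on_def image_iff)
  then have "card ?P = card {z\<in>nodes. prefix z l}"
    by (rule bij_betw_same_card)
  also have "{z\<in>nodes. prefix z l} = (\<lambda>i. take i l) ` {1..h}"
  proof (intro equalityI subsetI)
    fix z assume "z \<in> {z\<in>nodes. prefix z l}"
    then have "z = take (length z) l" "length z \<in> {1..h}"
      by (auto simp: nodes_iff prefix_def Suc_le_eq)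
    then show "z \<in> (\<lambda>i. take i l) ` {1..h}" by blast
  next
    fix z assume "z \<in> (\<lambda>i. take i l) ` {1..h}"
    then show "z \<in> {z\<in>nodes. prefix z l}"
      using l h2 by (auto simp: nodes_iff words_def take_is_prefix dest: in_set_takeD)
  qed
  also have "card \<dots> = h"
    using l by (subst card_image) (auto simp: inj_on_def words_def dest: arg_cong[of _ _ length])
  finally have cP: "card ?P = h" .
  have "{x\<in>outcomes. \<forall>v<m. prefix (e v) l \<longrightarrow> x v \<noteq> 0}
      = (\<Pi>\<^sub>E v\<in>{..<m}. if v \<in> ?P then {1..<h} else {..<h})"
  proof (intro equalityI subsetI)
    fix x assume "x \<in> {x\<in>outcomes. \<forall>v<m. prefix (e v) l \<longrightarrow> x v \<noteq> 0}"
    then show "x \<in> (\<Pi>\<^sub>E v\<in>{..<m}. if v \<in> ?P then {1..<h} else {..<h})"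
      by (auto simp: outcomes_def PiE_iff)
  next
    fix x assume x: "x \<in> (\<Pi>\<^sub>E v\<in>{..<m}. if v \<in> ?P then {1..<h} else {..<h})"
    have "x v < h \<and> (prefix (e v) l \<longrightarrow> x v \<noteq> 0)" if "v < m" for v
      using that PiE_mem[OF x, of v] by (auto split: if_splits)
    then show "x \<in> {x\<in>outcomes. \<forall>v<m. prefix (e v) l \<longrightarrow> x v \<noteq> 0}"
      using x by (auto simp: outcomes_def PiE_iff)
  qed
  then have "card {x\<in>outcomes. \<forall>v<m. prefix (e v) l \<longrightarrow> x v \<noteq> 0}
      = (\<Prod>v<m. if v \<in> ?P then h - 1 else h)"
    by (simp add: card_PiE if_distrib[of card] cong: if_cong)
  also have "\<dots> = (h - 1) ^ h * h ^ card ({..<m} - ?P)"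
  proof -
    have "{..<m} \<inter> {v. v \<in> ?P} = ?P" "{..<m} \<inter> - {v. v \<in> ?P} = {..<m} - ?P" by auto
    then show ?thesis unfolding prod.If_cases[OF finite_lessThan] prod_constant by (simp only: cP)
  qed
  finally have c: "card {x\<in>outcomes. \<forall>v<m. prefix (e v) l \<longrightarrow> x v \<noteq> 0}
      = (h - 1) ^ h * h ^ card ({..<m} - ?P)" .
  have "h + card ({..<m} - ?P) = m"
  proof -
    have "?P \<subseteq> {..<m}" by auto
    then show ?thesis
      using card_Diff_subset[of ?P "{..<m}"] card_mono[of "{..<m}" ?P] cP by simp
  qed
  then have "card outcomes = h ^ h * h ^ card ({..<m} - ?P)"
    by (simp add: card_outcomes flip: power_add)
  then show ?thesis using c two_power_le[OF h2] by simp
qed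

text \<open>The topmost valuable nodes are independent and cover the same leaves as all valuable
  nodes.\<close>

lemma OPT_value_ge:
  "real (card {l\<in>words h. \<exists>v<m. x v = 0 \<and> prefix (e v) l})
    \<le> OPT {..<m} adj (\<lambda>v\<in>{..<m}. payoff v (x v))"
proof -
  let ?Z = "{v\<in>{..<m}. x v = 0}"
  let ?S = "{v\<in>?Z. \<forall>u\<in>?Z. \<not> strict_prefix (e u) (e v)}"
  have "{l\<in>words h. \<exists>v<m. x v = 0 \<and> prefix (e v) l} = {l\<in>words h. \<exists>z\<in>e ` ?Z. prefix z l}"
    by auto
  then have "real (card {l\<in>words h. \<exists>v<m. x v = 0 \<and> prefix (e v) l})
      \<le> (\<Sum>z\<in>{z\<in>e ` ?Z. \<forall>u\<in>e ` ?Z. \<not> strict_prefix u z}. wt z)"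
    using roots_wt_ge[of "e ` ?Z"] e_nodes by auto
  also have "{z\<in>e ` ?Z. \<forall>u\<in>e ` ?Z. \<not> strict_prefix u z} = e ` ?S" by auto
  also have "(\<Sum>z\<in>e ` ?S. wt z) = (\<Sum>v\<in>?S. wt (e v))"
    by (subst sum.reindex) (auto simp: inj_on_def e_inj)
  also have "\<dots> = (\<Sum>v\<in>?S. (\<lambda>v\<in>{..<m}. payoff v (x v)) v)"
    by (intro sum.cong) (auto simp: payoff_def)
  also have "\<dots> \<le> OPT {..<m} adj (\<lambda>v\<in>{..<m}. payoff v (x v))"
    by (rule OPT_ge) (auto simp: independent_set_def adj_def comparable_def)
  finally show ?thesis .
qed

lemma sum_OPT_ge:
  "leaves / 2 * real (card outcomes)
    \<le> (\<Sum>x\<in>outcomes. OPT {..<m} adj (\<lambda>v\<in>{..<m}. payoff v (x v)))"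
proof -
  let ?C = "\<lambda>x l. \<exists>v<m. x v = 0 \<and> prefix (e v) l"
  have "real (card outcomes) / 2 \<le> real (card {x\<in>outcomes. ?C x l})" if l: "l \<in> words h" for l
  proof -
    have "card outcomes = card {x\<in>outcomes. ?C x l} + card {x\<in>outcomes. \<not> ?C x l}"
      using outcomes_finite by (subst card_Un_disjoint[symmetric]) (auto intro!: arg_cong[of _ _ card])
    moreover have "{x\<in>outcomes. \<not> ?C x l} = {x\<in>outcomes. \<forall>v<m. prefix (e v) l \<longrightarrow> x v \<noteq> 0}"
      by auto
    ultimately show ?thesis using uncovered_le[OF l] by simp
  qed
  then have "(\<Sum>l\<in>words h. real (card outcomes) / 2) \<le> (\<Sum>l\<in>words h. real (card {x\<in>outcomes. ?C x l}))"
    by (rule sum_mono)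
  also have "\<dots> = (\<Sum>l\<in>words h. \<Sum>x\<in>outcomes. if ?C x l then 1 else 0)"
    using outcomes_finite by (simp add: sum_if_const)
  also have "\<dots> = (\<Sum>x\<in>outcomes. \<Sum>l\<in>words h. if ?C x l then 1 else 0)"
    by (rule sum.swap)
  also have "\<dots> = (\<Sum>x\<in>outcomes. real (card {l\<in>words h. ?C x l}))"
    by (simp add: sum_if_const)
  also have "\<dots> \<le> (\<Sum>x\<in>outcomes. OPT {..<m} adj (\<lambda>v\<in>{..<m}. payoff v (x v)))"
    by (intro sum_mono OPT_value_ge)
  finally show ?thesis by (simp add: card_words)
qed

lemma PiM_node_dist:
  "(\<Pi>\<^sub>M v\<in>{..<m}. node_dist v)
    = distr (measure_pmf (pmf_of_set outcomes)) (\<Pi>\<^sub>M v\<in>{..<m}. borel) (\<lambda>x. \<lambda>v\<in>{..<m}. payoff v (x v))"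
  unfolding node_dist_def outcomes_def
  using h2 by (intro PiM_distr_pmf_of_set) (auto simp: lessThan_empty_iff)

lemma integral_PiM_node_dist:
  fixes f :: "(nat \<Rightarrow> real) \<Rightarrow> real"
  assumes "f \<in> borel_measurable (\<Pi>\<^sub>M v\<in>{..<m}. borel)"
  shows "(\<integral>w. f w \<partial>(\<Pi>\<^sub>M v\<in>{..<m}. node_dist v))
    = (\<Sum>x\<in>outcomes. f (\<lambda>v\<in>{..<m}. payoff v (x v))) / real (card outcomes)"
proof -
  have F: "(\<lambda>x. \<lambda>v\<in>{..<m}. payoff v (x v)) \<in> measure_pmf (pmf_of_set outcomes) \<rightarrow>\<^sub>M (\<Pi>\<^sub>M v\<in>{..<m}. borel)"
    by (auto simp: space_PiM)
  show ?thesis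
    unfolding PiM_node_dist using outcomes_finite outcomes_nonempty
    by (subst integral_distr[OF F assms]) (simp add: integral_pmf_of_set)
qed

text \<open>The enumeration \<open>e\<close> already lists the nodes in their order of arrival,
  hence the order \<open>id\<close>.\<close>

lemma prophet_instance_tree: "prophet_instance m adj node_dist id"
proof -
  have "interval_graph {..<m} adj"
    unfolding adj_def[abs_def] using bij e_nodes d_pos
    by (intro interval_graph_comparable[where d = d]) (auto simp: bij_betw_def nodes_iff)
  moreover have "prob_space (node_dist v)" for v
    unfolding node_dist_def by (rule measure_pmf.prob_space_distr) simp
  moreover have "AE y in node_dist v. 0 \<le> y" for v
    unfolding node_dist_def using wt_pos[of "e v"]
    by (subst AE_distr_iff) (auto simp: payoff_def)
  moreover have "integrable (node_dist v) (\<lambda>y. y)" for v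
    unfolding node_dist_def using h2
    by (subst integrable_distr_eq) (auto intro!: integrable_measure_pmf_finite simp: set_pmf_of_set lessThan_empty_iff)
  moreover have "sets (node_dist v) = sets borel" for v
    by (simp add: node_dist_def)
  ultimately show ?thesis
    unfolding prophet_instance_def by (simp add: permutes_id)
qed

lemma prophet_OPT_ge: "leaves / 2 \<le> prophet_OPT m adj node_dist"
proof -
  have "real (card outcomes) > 0"
    using outcomes_finite outcomes_nonempty by (simp add: card_gt_0_iff)
  then show ?thesis
    unfolding prophet_OPT_def
    by (subst integral_PiM_node_dist)
       (use sum_OPT_ge in \<open>auto simp: borel_measurable_OPT field_simps\<close>)
qed

lemma prophet_ALG_le:
  assumes A: "online_algorithm R A"
  shows "prophet_ALG m adj node_dist id R A \<le> 2 * leaves / real h"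
proof -
  let ?P = "\<Pi>\<^sub>M v\<in>{..<m}. node_dist v"
  let ?f = "\<lambda>(r, w). ALG A r (observations m adj w id)"
  have c: "real (card outcomes) > 0"
    using outcomes_finite outcomes_nonempty by (simp add: card_gt_0_iff)
  interpret R: prob_space R using A by (simp add: online_algorithm_def)
  interpret P: prob_space ?P
    by (intro prob_space_PiM) (simp add: node_dist_def measure_pmf.prob_space_distr)
  interpret pair_sigma_finite R ?P ..
  show ?thesis
  proof (cases "integrable (R \<Otimes>\<^sub>M ?P) ?f")
    case True
    have sP: "sets ?P = sets (\<Pi>\<^sub>M v\<in>{..<m}. (borel :: real measure))"
      by (intro sets_PiM_cong) (auto simp: node_dist_def)
    \<comment> \<open>The seed is independent of the weights, so the bound for deterministic rules
      applies to each seed separately.\<close>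
    have inner: "(\<integral>w. ?f (r, w) \<partial>?P) \<le> 2 * leaves / real h" if r: "r \<in> space R" for r
    proof -
      have "(\<lambda>w. ?f (r, w)) \<in> borel_measurable ?P"
        using measurable_compose[OF measurable_Pair1'[OF r] borel_measurable_integrable[OF True]] .
      then have "(\<lambda>w. ?f (r, w)) \<in> borel_measurable (\<Pi>\<^sub>M v\<in>{..<m}. borel)"
        by (simp add: measurable_cong_sets[OF sP refl])
      from integral_PiM_node_dist[OF this]
      have "(\<integral>w. ?f (r, w) \<partial>?P)
          = (\<Sum>x\<in>outcomes. ALG A r (observations m adj (\<lambda>v\<in>{..<m}. payoff v (x v)) id)) / real (card outcomes)"
        by simp
      also have "(\<Sum>x\<in>outcomes. ALG A r (observations m adj (\<lambda>v\<in>{..<m}. payoff v (x v)) id))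
          = (\<Sum>x\<in>outcomes. gain (A r) x)"
      proof (rule sum.cong[OF refl])
        fix x
        have "observations m adj (\<lambda>v\<in>{..<m}. payoff v (x v)) id = map (obs x) [0..<m]"
          unfolding observations_def by (intro map_cong) (auto simp: obs_def)
        then show "ALG A r (observations m adj (\<lambda>v\<in>{..<m}. payoff v (x v)) id) = gain (A r) x"
          by (simp add: ALG_eq_gain)
      qed
      also have "\<dots> / real (card outcomes) \<le> 2 * leaves / real h"
        using sum_gain_le[OF online_algorithm_feasible[OF A], of r] c by (simp add: pos_divide_le_eq)
      finally show ?thesis .
    qed
    have "prophet_ALG m adj node_dist id R A = (\<integral>r. (\<integral>w. ?f (r, w) \<partial>?P) \<partial>R)"
      unfolding prophet_ALG_def by (rule integral_fst'[OF True, symmetric])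
    also have "\<dots> \<le> 2 * leaves / real h"
      using inner by (intro R.integral_le_const integrable_fst'[OF True]) auto
    finally show ?thesis .
  next
    \<comment> \<open>The integral of a non-integrable function is \<open>0\<close> by convention,
      and the bound is nonnegative.\<close>
    case False
    then show ?thesis
      unfolding prophet_ALG_def by (simp add: not_integrable_integral_eq)
  qed
qed

end

lemma (in interval_tree) bottom_up_enumeration:
  obtains e where "bottom_up_tree h d (card nodes) e"
proof -
  obtain xs where xs: "set xs = nodes" "distinct xs"
    using finite_distinct_list[OF finite_nodes] by blast
  \<comment> \<open>The key is the height above the leaf level, so the leaves come first.\<close>
  let ?ys = "sort_key (\<lambda>z. h - length z) xs"
  have ys: "set ?ys = nodes" "distinct ?ys" "length ?ys = card nodes"
    using xs distinct_card[of xs] by auto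
  have "bottom_up_tree h d (card nodes) ((!) ?ys)"
  proof
    show "bij_betw ((!) ?ys) {..<card nodes} nodes"
      using bij_betw_nth[of ?ys] ys by metis
    fix i j assume ij: "i \<le> j" "j < card nodes"
    have "sorted (map (\<lambda>z. h - length z) ?ys)" by simp
    then have "h - length (?ys ! i) \<le> h - length (?ys ! j)"
      using ij ys(3) sorted_nth_mono[of "map (\<lambda>z. h - length z) ?ys" i j] by simp
    moreover have "?ys ! i \<in> nodes" "?ys ! j \<in> nodes"
      using ij ys nth_mem[of i ?ys] nth_mem[of j ?ys] by auto
    ultimately show "length (?ys ! j) \<le> length (?ys ! i)"
      by (auto simp: nodes_iff)
  qed
  then show ?thesis using that by blast
qed

lemma (in interval_tree) card_nodes_le: "card nodes \<le> h * d ^ h"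
proof -
  have "card nodes \<le> (\<Sum>i\<in>{1..h}. card (words i))"
    unfolding nodes_def by (rule card_UN_le) simp
  also have "\<dots> \<le> (\<Sum>i\<in>{1..h}. d ^ h)"
    using d_pos by (intro sum_mono) (auto simp: card_words intro: power_increasing)
  finally show ?thesis by simp
qed

subsection \<open>Secretaries\<close>

lemma card_le_fibers:
  assumes "finite X" "finite Y" "F ` X \<subseteq> Y" "\<And>y. y \<in> Y \<Longrightarrow> card {x\<in>X. F x = y} \<le> k"
  shows "card X \<le> k * card Y"
proof -
  have "card X = (\<Sum>y\<in>Y. card {x\<in>X. F x = y})"
    using sum.group[OF assms(1-3), of "\<lambda>_. 1 :: nat"] by simp
  also have "\<dots> \<le> (\<Sum>y\<in>Y. k)" by (rule sum_mono) (rule assms(4))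
  finally show ?thesis by (simp add: mult.commute)
qed

lemma inverse_le_ln_diff:
  assumes "(x::real) > 1"
  shows "1 / x \<le> ln x - ln (x - 1)"
proof -
  have "ln ((x - 1) / x) \<le> (x - 1) / x - 1"
    using assms by (intro ln_le_minus_one) simp
  also have "(x - 1) / x - 1 = - (1 / x)" using assms by (simp add: diff_divide_distrib)
  also have "ln ((x - 1) / x) = ln (x - 1) - ln x" using assms by (simp add: ln_div)
  finally show ?thesis by simp
qed

text \<open>At time \<open>t\<close> there are \<open>N - t\<close> arrivals left. Stopping while
  \<open>M\<close> of them remain makes the sum telescope to a logarithm of
  \<open>N / M\<close>.\<close>

lemma harmonic_tail_le:
  assumes "1 \<le> M" "M \<le> N"
  shows "(\<Sum>t<N - M. 1 / real (N - t)) \<le> ln (real N / real M)"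
proof -
  have "(\<Sum>t<N - M. 1 / real (N - t)) \<le> (\<Sum>t<N - M. ln (real (N - t)) - ln (real (N - Suc t)))"
  proof (rule sum_mono)
    fix t assume "t \<in> {..<N - M}"
    then have k: "real (N - Suc t) = real (N - t) - 1" "real (N - t) > 1"
      using assms by auto
    show "1 / real (N - t) \<le> ln (real (N - t)) - ln (real (N - Suc t))"
      unfolding k(1) by (rule inverse_le_ln_diff[OF k(2)])
  qed
  also have "\<dots> = ln (real N) - ln (real M)"
    using assms by (subst sum_lessThan_telescope') simp
  finally show ?thesis using assms by (simp add: ln_div)
qed

text \<open>Used at each vertex of the tree to move the first \<open>k\<close> letters onto a
  prescribed set of present children.\<close>

lemma exists_bij_extending:
  assumes "A \<subseteq> {..<d}" "card A = k"
  shows "\<exists>p. bij_betw p {..<d} {..<d} \<and> p ` {..<k} = A"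
proof -
  have fA: "finite A" using assms finite_subset by blast
  have kd: "k \<le> d" using card_mono[of "{..<d}" A] assms by simp
  obtain f where f: "bij_betw f {..<k} A"
    using finite_same_card_bij[of "{..<k}" A] fA assms by auto
  obtain g where g: "bij_betw g {k..<d} ({..<d} - A)"
    using finite_same_card_bij[of "{k..<d}" "{..<d} - A"] assms fA
    by (auto simp: card_Diff_subset)
  let ?p = "\<lambda>i. if i < k then f i else g i"
  have 1: "bij_betw ?p {..<k} A"
    using f by (rule bij_betw_cong[THEN iffD1, rotated]) auto
  have 2: "bij_betw ?p {k..<d} ({..<d} - A)"
    using g by (rule bij_betw_cong[THEN iffD1, rotated]) auto
  have "bij_betw ?p ({..<k} \<union> {k..<d}) (A \<union> ({..<d} - A))"
    by (rule bij_betw_combine[OF 1 2]) auto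
  moreover have "{..<k} \<union> {k..<d} = {..<d}" "A \<union> ({..<d} - A) = {..<d}"
    using assms kd by auto
  ultimately have "bij_betw ?p {..<d} {..<d}" by (simp only:)
  with bij_betw_imp_surj_on[OF 1] show ?thesis by blast
qed

text \<open>A tree automorphism: below each vertex the letters are permuted by \<open>P\<close>,
  taken at the image of that vertex. The argument \<open>q\<close> accumulates this image.\<close>

primrec walk :: "(nat list \<Rightarrow> nat \<Rightarrow> nat) \<Rightarrow> nat list \<Rightarrow> nat list \<Rightarrow> nat list" where
  "walk P q [] = []"
| "walk P q (k # ks) = P q k # walk P (q @ [P q k]) ks"

lemma length_walk [simp]: "length (walk P q xs) = length xs"
  by (induction xs arbitrary: q) auto

lemma walk_snoc: "walk P q (xs @ [k]) = walk P q xs @ [P (q @ walk P q xs) k]"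
  by (induction xs arbitrary: q) auto

lemma set_walk:
  assumes "\<And>q. bij_betw (P q) {..<d} {..<d}" "set xs \<subseteq> {..<d}"
  shows "set (walk P q xs) \<subseteq> {..<d}"
  using assms(2) by (induction xs arbitrary: q) (use bij_betwE[OF assms(1)] in auto)

text \<open>As long as two words agree they meet the same permutations, and at the first difference
  injectivity keeps them apart.\<close>

lemma prefix_walk_iff:
  assumes "\<And>q. bij_betw (P q) {..<d} {..<d}" "set xs \<subseteq> {..<d}" "set ys \<subseteq> {..<d}"
  shows "prefix (walk P q xs) (walk P q ys) \<longleftrightarrow> prefix xs ys"
  using assms(2,3)
proof (induction xs arbitrary: q ys)
  case (Cons k xs)
  show ?case
  proof (cases ys)
    case (Cons k' zs)
    have "P q k = P q k' \<longleftrightarrow> k = k'"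
      using assms(1)[of q] Cons.prems Cons by (auto simp: bij_betw_def dest: inj_onD)
    then show ?thesis using Cons.IH[of zs] Cons.prems Cons by auto
  qed simp
qed simp

text \<open>A random order of any set is a random permutation followed by a fixed enumeration.
  Restriction gives every order a single representing function.\<close>

lemma bij_betw_compose_permutations:
  assumes c: "bij_betw c {..<N} R"
  shows "bij_betw (\<lambda>\<pi>. restrict (c \<circ> \<pi>) {..<N}) {\<pi>. \<pi> permutes {..<N}}
    {\<phi> \<in> extensional {..<N}. bij_betw \<phi> {..<N} R}"
proof (rule bij_betw_imageI)
  show "inj_on (\<lambda>\<pi>. restrict (c \<circ> \<pi>) {..<N}) {\<pi>. \<pi> permutes {..<N}}"
  proof (rule inj_onI, simp)
    fix \<pi> \<rho> assume p: "\<pi> permutes {..<N}" "\<rho> permutes {..<N}"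
      and eq: "restrict (c \<circ> \<pi>) {..<N} = restrict (c \<circ> \<rho>) {..<N}"
    show "\<pi> = \<rho>"
    proof
      fix t
      show "\<pi> t = \<rho> t"
      proof (cases "t < N")
        case True
        then have "c (\<pi> t) = c (\<rho> t)" using fun_cong[OF eq, of t] by simp
        then show ?thesis
          using c permutes_in_image[OF p(1), of t] permutes_in_image[OF p(2), of t] True
          by (auto simp: bij_betw_def dest: inj_onD)
      qed (use p in \<open>simp add: permutes_def\<close>)
    qed
  qed
  show "(\<lambda>\<pi>. restrict (c \<circ> \<pi>) {..<N}) ` {\<pi>. \<pi> permutes {..<N}}
      = {\<phi> \<in> extensional {..<N}. bij_betw \<phi> {..<N} R}"
  proof (intro equalityI subsetI)
    fix \<phi> assume "\<phi> \<in> (\<lambda>\<pi>. restrict (c \<circ> \<pi>) {..<N}) ` {\<pi>. \<pi> permutes {..<N}}"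
    then obtain \<pi> where p: "\<pi> permutes {..<N}" "\<phi> = restrict (c \<circ> \<pi>) {..<N}" by auto
    have "bij_betw (c \<circ> \<pi>) {..<N} R"
      using bij_betw_trans[OF permutes_imp_bij[OF p(1)] c] .
    then have "bij_betw \<phi> {..<N} R"
      by (rule bij_betw_cong[THEN iffD1, rotated]) (simp add: p(2))
    then show "\<phi> \<in> {\<phi> \<in> extensional {..<N}. bij_betw \<phi> {..<N} R}" by (simp add: p(2))
  next
    fix \<phi> assume f: "\<phi> \<in> {\<phi> \<in> extensional {..<N}. bij_betw \<phi> {..<N} R}"
    let ?\<pi> = "\<lambda>t. if t < N then inv_into {..<N} c (\<phi> t) else t"
    have "bij_betw (inv_into {..<N} c \<circ> \<phi>) {..<N} {..<N}"
      using f bij_betw_trans[OF _ bij_betw_inv_into[OF c]] by blast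
    then have "bij_betw ?\<pi> {..<N} {..<N}"
      by (rule bij_betw_cong[THEN iffD1, rotated]) simp
    then have "?\<pi> permutes {..<N}" by (rule bij_imp_permutes) simp
    moreover have "\<phi> = restrict (c \<circ> ?\<pi>) {..<N}"
    proof
      fix t
      have "t < N \<Longrightarrow> \<phi> t \<in> c ` {..<N}" using f c by (auto simp: bij_betw_def)
      then show "\<phi> t = restrict (c \<circ> ?\<pi>) {..<N} t"
        using f by (auto simp: f_inv_into_f extensional_def)
    qed
    ultimately show "\<phi> \<in> (\<lambda>\<pi>. restrict (c \<circ> \<pi>) {..<N}) ` {\<pi>. \<pi> permutes {..<N}}" by blast
  qed
qed

text \<open>Fixing the weights in the joint measurability condition leaves a section in the seed
  alone.\<close>

lemma online_algorithm_measurable: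
  assumes "online_algorithm R A"
  shows "Measurable.pred R (\<lambda>r. A r os)"
proof -
  let ?k = "length os" and ?N = "\<lambda>i. snd (os ! i)" and ?x = "\<lambda>i\<in>{..<length os}. fst (os ! i)"
  note * = assms[unfolded online_algorithm_def, THEN conjunct2, THEN conjunct2, THEN conjunct2]
  have "Measurable.pred (borel \<Otimes>\<^sub>M (\<Pi>\<^sub>M i\<in>{..<?k}. borel))
      (\<lambda>(r, x). A r (map (\<lambda>i. (x i, ?N i)) [0..<?k]))"
    by (rule spec[OF spec[OF *, of ?k], of ?N])
  moreover have "(\<lambda>r. (r, ?x)) \<in> (borel :: real measure) \<rightarrow>\<^sub>M borel \<Otimes>\<^sub>M (\<Pi>\<^sub>M i\<in>{..<?k}. borel)"
    by (rule measurable_Pair2') (auto simp: space_PiM)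
  ultimately have "Measurable.pred borel (\<lambda>r. (\<lambda>(r, x). A r (map (\<lambda>i. (x i, ?N i)) [0..<?k])) (r, ?x))"
    by (rule measurable_compose[rotated])
  moreover have "map (\<lambda>i. (?x i, ?N i)) [0..<?k] = os"
    by (rule nth_equalityI) auto
  ultimately have "Measurable.pred borel (\<lambda>r. A r os)" by simp
  moreover have "sets R = sets borel" using assms by (simp add: online_algorithm_def)
  ultimately show ?thesis by (simp add: measurable_cong_sets)
qed

lemma integrable_ALG:
  assumes A: "online_algorithm R A"
  shows "integrable R (\<lambda>r. ALG A r os)"
proof -
  interpret prob_space R using A by (simp add: online_algorithm_def)
  have "ALG A r os = (\<Sum>t<length os. if A r (take (Suc t) os) then fst (os ! t) else 0)" for r
    unfolding ALG_def accepted_def by (simp add: sum_if_filter)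
  moreover have "integrable R (\<lambda>r. if A r (take (Suc t) os) then fst (os ! t) else 0)" for t
    using online_algorithm_measurable[OF A, of "take (Suc t) os"]
    by (intro integrable_const_bound[of _ "\<bar>fst (os ! t)\<bar>"]) (auto intro!: measurable_If)
  ultimately show ?thesis by simp
qed

section \<open>The family of hidden instances and their isomorphisms\<close>

context interval_tree
begin

text \<open>In contrast to \<open>nodes\<close>, the root belongs here and the leaves do
  not.\<close>

definition parents :: "nat list set" where
  "parents = (\<Union>i\<in>{..<h}. words i)"

definition children :: "nat list \<Rightarrow> nat list set" where
  "children q = (\<lambda>k. q @ [k]) ` {..<d}"

text \<open>The family of hidden instances. All of them are isomorphic, so a uniformly random order of one of
  them looks like a uniformly random order of a uniformly random member of the family.\<close>

definition present_sets :: "nat list set set" where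
  "present_sets = {R. R \<subseteq> nodes \<and> (\<forall>q\<in>parents. card (R \<inter> children q) = h)}"

text \<open>The member of the family that is actually played: the first \<open>h\<close> children of
  every parent. Below every parent there are \<open>h\<close> present children, whether or not the
  parent itself is present.\<close>

definition base_set :: "nat list set" where
  "base_set = {v\<in>nodes. last v < h}"

definition num_present :: nat where
  "num_present = h * card parents"

lemma parents_iff: "q \<in> parents \<longleftrightarrow> set q \<subseteq> {..<d} \<and> length q < h"
  by (auto simp: parents_def words_def)

lemma finite_parents [simp]: "finite parents"
  by (simp add: parents_def)

lemma finite_children [simp]: "finite (children q)" and card_children: "card (children q) = d"
  by (auto simp: children_def card_image inj_on_def)

lemma mem_children_iff: "v \<in> children q \<longleftrightarrow> v \<noteq> [] \<and> butlast v = q \<and> last v < d"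
  by (auto simp: children_def image_iff) (metis append_butlast_last_id lessThan_iff)

lemma node_parent:
  assumes "v \<in> nodes"
  shows "butlast v \<in> parents" "v \<in> children (butlast v)"
proof -
  have v: "set v \<subseteq> {..<d}" "v \<noteq> []" "length v \<le> h" "length v > 0"
    using assms by (auto simp: nodes_iff)
  have "last v < d" using v last_in_set[of v] by blast
  then show "v \<in> children (butlast v)" using v by (simp add: mem_children_iff)
  have "length (butlast v) < h" unfolding length_butlast using v by linarith
  then show "butlast v \<in> parents" using v by (auto simp: parents_iff dest: in_set_butlastD)
qed

lemma children_nodes: "q \<in> parents \<Longrightarrow> children q \<subseteq> nodes"
  by (auto simp: children_def nodes_iff parents_iff)

lemma present_Union:
  assumes "R \<subseteq> nodes"
  shows "R = (\<Union>q\<in>parents. R \<inter> children q)"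
  using assms node_parent by blast

lemma finite_present: "R \<in> present_sets \<Longrightarrow> finite R"
  using finite_subset[OF _ finite_nodes] by (auto simp: present_sets_def)

lemma finite_present_sets: "finite present_sets"
  by (rule finite_subset[of _ "Pow nodes"]) (auto simp: present_sets_def)

lemma card_present:
  assumes "R \<in> present_sets"
  shows "card R = num_present"
proof -
  have "card R = card (\<Union>q\<in>parents. R \<inter> children q)"
    using present_Union assms by (auto simp: present_sets_def)
  also have "\<dots> = (\<Sum>q\<in>parents. card (R \<inter> children q))"
    by (rule card_UN_disjoint) (auto simp: mem_children_iff)
  also have "\<dots> = num_present"
    using assms by (simp add: present_sets_def num_present_def)
  finally show ?thesis .
qed

text \<open>A fraction \<open>h / d = 1 / h\<close> of each level is present, and there are
  \<open>h\<close> levels of weight \<open>leaves\<close>.\<close>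

lemma sum_wt_present:
  assumes R: "R \<in> present_sets"
  shows "(\<Sum>v\<in>R. wt v) = leaves"
proof -
  have "(\<Sum>v\<in>R. wt v) = (\<Sum>v\<in>(\<Union>q\<in>parents. R \<inter> children q). wt v)"
    using present_Union R by (auto simp: present_sets_def)
  also have "\<dots> = (\<Sum>q\<in>parents. \<Sum>v\<in>R \<inter> children q. wt v)"
    by (rule sum.UNION_disjoint) (auto simp: mem_children_iff)
  also have "\<dots> = (\<Sum>q\<in>parents. real h * real d ^ (h - Suc (length q)))"
  proof (rule sum.cong[OF refl])
    fix q assume q: "q \<in> parents"
    have "(\<Sum>v\<in>R \<inter> children q. wt v) = (\<Sum>v\<in>R \<inter> children q. real d ^ (h - Suc (length q)))"
      by (rule sum.cong) (auto simp: children_def wt_def)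
    then show "(\<Sum>v\<in>R \<inter> children q. wt v) = real h * real d ^ (h - Suc (length q))"
      using R q by (simp add: present_sets_def)
  qed
  also have "\<dots> = (\<Sum>i<h. \<Sum>q\<in>words i. real h * real d ^ (h - Suc (length q)))"
    unfolding parents_def by (rule sum.UNION_disjoint) (simp_all, auto simp: words_def)
  also have "\<dots> = (\<Sum>i<h. real h * real d ^ (h - 1))"
  proof (rule sum.cong[OF refl])
    fix i assume i: "i \<in> {..<h}"
    have "(\<Sum>q\<in>words i. real h * real d ^ (h - Suc (length q)))
        = (\<Sum>q\<in>words i. real h * real d ^ (h - Suc i))"
      by (rule sum.cong) (auto simp: words_def)
    also have "\<dots> = real h * (real d ^ i * real d ^ (h - Suc i))"
      by (simp add: card_words)
    also have "real d ^ i * real d ^ (h - Suc i) = real d ^ (h - 1)"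
      using i by (simp flip: power_add)
    finally show "(\<Sum>q\<in>words i. real h * real d ^ (h - Suc (length q))) = real h * real d ^ (h - 1)" .
  qed
  also have "\<dots> = real d * real d ^ (h - 1)" by (simp add: d_eq)
  also have "\<dots> = leaves" using h2 by (simp flip: power_Suc)
  finally show ?thesis .
qed

lemma base_present: "base_set \<in> present_sets"
proof -
  have "card (base_set \<inter> children q) = h" if q: "q \<in> parents" for q
  proof -
    have "base_set \<inter> children q = (\<lambda>k. q @ [k]) ` {..<h}"
      using q h_less_d by (auto simp: base_set_def children_def nodes_iff parents_iff)
    then show ?thesis by (simp add: card_image inj_on_def)
  qed
  then show ?thesis by (auto simp: present_sets_def base_set_def)
qed

text \<open>A walk whose permutations send the first \<open>h\<close> letters at each vertex to its
  present children. It preserves lengths and comparability, which is all that the observations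
  reveal.\<close>

lemma present_isomorphic:
  assumes R: "R \<in> present_sets"
  obtains g where "bij_betw g base_set R" "\<And>x. x \<in> base_set \<Longrightarrow> length (g x) = length x"
    "\<And>x y. x \<in> base_set \<Longrightarrow> y \<in> base_set \<Longrightarrow> comparable (g x) (g y) \<longleftrightarrow> comparable x y"
proof -
  \<comment> \<open>The choice has to be total for \<open>walk\<close>; outside
    \<open>parents\<close> the identity serves.\<close>
  have "\<exists>p. bij_betw p {..<d} {..<d} \<and> (q \<in> parents \<longrightarrow> p ` {..<h} = {k\<in>{..<d}. q @ [k] \<in> R})" for q
  proof (cases "q \<in> parents")
    case True
    have "R \<inter> children q = (\<lambda>k. q @ [k]) ` {k\<in>{..<d}. q @ [k] \<in> R}"
      by (auto simp: children_def)
    then have "card {k\<in>{..<d}. q @ [k] \<in> R} = card (R \<inter> children q)"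
      by (simp add: card_image inj_on_def)
    also have "\<dots> = h" using R True by (simp add: present_sets_def)
    finally show ?thesis using exists_bij_extending[of "{k\<in>{..<d}. q @ [k] \<in> R}" d h] by auto
  next
    case False
    then show ?thesis by (auto intro!: exI[of _ id])
  qed
  then obtain P where P: "\<And>q. bij_betw (P q) {..<d} {..<d}"
    "\<And>q. q \<in> parents \<Longrightarrow> P q ` {..<h} = {k\<in>{..<d}. q @ [k] \<in> R}"
    by metis
  let ?g = "walk P []"
  have dig: "set x \<subseteq> {..<d}" if "x \<in> base_set" for x
    using that by (simp add: base_set_def nodes_iff)
  have inj: "inj_on ?g base_set"
  proof (rule inj_onI)
    fix x y assume "x \<in> base_set" "y \<in> base_set" "?g x = ?g y"
    then show "x = y"
      using dig prefix_walk_iff[where P = P, OF P(1), of x y "[]"]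
        prefix_walk_iff[where P = P, OF P(1), of y x "[]"] by (simp add: prefix_order.eq_iff)
  qed
  have "?g x \<in> R" if x: "x \<in> base_set" for x
  proof -
    have x': "x = butlast x @ [last x]" "last x < h" "butlast x \<in> parents"
      using x node_parent by (auto simp: base_set_def nodes_iff)
    let ?y = "walk P [] (butlast x)"
    have y: "?y \<in> parents"
      using set_walk[where P = P, OF P(1), of "butlast x" "[]"] x'(3) by (auto simp: parents_iff)
    have "?g x = ?y @ [P ?y (last x)]"
      using walk_snoc[of P "[]" "butlast x" "last x"] x'(1) by simp
    moreover have "P ?y (last x) \<in> P ?y ` {..<h}" using x'(2) by simp
    ultimately show ?thesis using P(2)[OF y] by auto
  qed
  then have "?g ` base_set = R"
    using card_image[OF inj] card_present[OF R] card_present[OF base_present] finite_present[OF R]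
    by (intro card_subset_eq) auto
  then have "bij_betw ?g base_set R" using inj by (simp add: bij_betw_def)
  moreover have "comparable (?g x) (?g y) \<longleftrightarrow> comparable x y" if "x \<in> base_set" "y \<in> base_set" for x y
    using that dig prefix_walk_iff[where P = P, OF P(1), of x y] prefix_walk_iff[where P = P, OF P(1), of y x]
    by (auto simp: comparable_def prefix_order.less_le_not_le)
  ultimately show ?thesis using that[of ?g] by simp
qed

text \<open>A hidden instance together with an order of its nodes. Extensionality makes this a
  finite set, over which averages are taken.\<close>

definition arrivals :: "(nat \<Rightarrow> nat list) set" where
  "arrivals = {\<phi> \<in> extensional {..<num_present}.
     inj_on \<phi> {..<num_present} \<and> \<phi> ` {..<num_present} \<in> present_sets}"

definition arrival_obs :: "(nat \<Rightarrow> nat list) \<Rightarrow> nat \<Rightarrow> observation" where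
  "arrival_obs \<phi> t = (wt (\<phi> t), {s. s < t \<and> comparable (\<phi> s) (\<phi> t)})"

text \<open>The node \<open>u\<close> may be absent from the instance: eligibility only asks what the algorithm would
  do if \<open>u\<close> arrived at time \<open>t\<close>.\<close>

definition eligible ::
    "(observation list \<Rightarrow> bool) \<Rightarrow> (nat \<Rightarrow> nat list) \<Rightarrow> nat \<Rightarrow> nat list \<Rightarrow> bool" where
  "eligible a \<phi> t u \<longleftrightarrow> u \<notin> \<phi> ` {..<t} \<and>
     a (map (arrival_obs \<phi>) [0..<t] @ [(wt u, {s. s < t \<and> comparable (\<phi> s) u})])"

text \<open>The ancestor is tested at the same time \<open>t\<close> and may be absent, so the
  verdict depends only on the history before \<open>t\<close> and on the node
  \<open>\<phi> t\<close>.\<close>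

definition dominated :: "(observation list \<Rightarrow> bool) \<Rightarrow> (nat \<Rightarrow> nat list) \<Rightarrow> nat \<Rightarrow> bool" where
  "dominated a \<phi> t \<longleftrightarrow> (\<exists>u\<in>nodes. strict_prefix u (\<phi> t) \<and> eligible a \<phi> t u)"

definition collected :: "(observation list \<Rightarrow> bool) \<Rightarrow> (nat \<Rightarrow> nat list) \<Rightarrow> real" where
  "collected a \<phi> = (\<Sum>t<num_present. if a (map (arrival_obs \<phi>) [0..<Suc t]) then wt (\<phi> t) else 0)"

section \<open>Acceptances of dominated and of undominated nodes\<close>

lemma arrivals_nodes: "\<phi> \<in> arrivals \<Longrightarrow> t < num_present \<Longrightarrow> \<phi> t \<in> nodes"
  by (auto simp: arrivals_def present_sets_def)

lemma arrivals_inj: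
  "\<phi> \<in> arrivals \<Longrightarrow> s < num_present \<Longrightarrow> t < num_present \<Longrightarrow> \<phi> s = \<phi> t \<longleftrightarrow> s = t"
  by (auto simp: arrivals_def dest: inj_onD)

lemma finite_arrivals: "finite arrivals"
proof (rule finite_subset)
  show "arrivals \<subseteq> {..<num_present} \<rightarrow>\<^sub>E nodes"
  proof
    fix \<phi> assume "\<phi> \<in> arrivals"
    then show "\<phi> \<in> {..<num_present} \<rightarrow>\<^sub>E nodes"
      using arrivals_nodes by (simp add: PiE_iff) (simp add: arrivals_def)
  qed
qed (auto intro: finite_PiE)

lemma eligible_cong:
  assumes "\<And>s. s < t \<Longrightarrow> \<phi> s = \<psi> s"
  shows "eligible a \<phi> t u \<longleftrightarrow> eligible a \<psi> t u"
proof -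
  have "map (arrival_obs \<phi>) [0..<t] = map (arrival_obs \<psi>) [0..<t]"
    using assms by (intro map_cong) (auto simp: arrival_obs_def)
  moreover have "\<phi> ` {..<t} = \<psi> ` {..<t}"
    using assms by (intro image_cong) auto
  moreover have "{s. s < t \<and> comparable (\<phi> s) u} = {s. s < t \<and> comparable (\<psi> s) u}"
    using assms by auto
  ultimately show ?thesis by (simp only: eligible_def)
qed

lemma accepts_iff_eligible:
  assumes "\<phi> \<in> arrivals" "t < num_present"
  shows "a (map (arrival_obs \<phi>) [0..<Suc t]) \<longleftrightarrow> eligible a \<phi> t (\<phi> t)"
proof -
  have "\<phi> t \<notin> \<phi> ` {..<t}"
    using arrivals_inj[OF assms(1) assms(2)] assms(2) by (metis image_iff lessThan_iff less_irrefl less_trans)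
  then show ?thesis by (simp add: eligible_def arrival_obs_def)
qed

text \<open>Had \<open>\<phi> s\<close> been accepted, its ancestor \<open>u\<close> could not be
  accepted if it turned up at the later time \<open>t\<close>.\<close>

lemma eligible_blocked:
  assumes a: "feasible_rule a" and \<phi>: "\<phi> \<in> arrivals" and "s < t" "t < num_present"
    and "eligible a \<phi> t u" "strict_prefix u (\<phi> s)"
  shows "\<not> eligible a \<phi> s (\<phi> s)"
proof -
  have "\<not> a (map (arrival_obs \<phi>) [0..<Suc s])"
    using assms by (intro feasible_rule_blocks[OF a, of _ t "wt u" "{s. s < t \<and> comparable (\<phi> s) u}"])
      (auto simp: eligible_def comparable_def)
  then show ?thesis using accepts_iff_eligible[OF \<phi>, of s] assms by simp
qed

text \<open>Each such acceptance is charged to an eligible proper ancestor. By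
  \<open>eligible_blocked\<close> an ancestor is charged at most once, and with at most
  \<open>wt u / d\<close>.\<close>

lemma dominated_collected_le:
  assumes a: "feasible_rule a" and \<phi>: "\<phi> \<in> arrivals"
  shows "(\<Sum>t<num_present. if eligible a \<phi> t (\<phi> t) \<and> dominated a \<phi> t then wt (\<phi> t) else 0)
    \<le> leaves / real h"
proof -
  let ?Q = "\<lambda>t u. eligible a \<phi> t (\<phi> t) \<and> strict_prefix u (\<phi> t) \<and> eligible a \<phi> t u"
  let ?g = "\<lambda>t u. if ?Q t u then wt (\<phi> t) else 0"
  have g0: "0 \<le> ?g t u" for t u using wt_pos[of "\<phi> t"] by simp
  have "(\<Sum>t<num_present. if eligible a \<phi> t (\<phi> t) \<and> dominated a \<phi> t then wt (\<phi> t) else 0)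
      \<le> (\<Sum>t<num_present. \<Sum>u\<in>nodes. ?g t u)"
  proof (rule sum_mono)
    fix t
    show "(if eligible a \<phi> t (\<phi> t) \<and> dominated a \<phi> t then wt (\<phi> t) else 0) \<le> (\<Sum>u\<in>nodes. ?g t u)"
    proof (cases "eligible a \<phi> t (\<phi> t) \<and> dominated a \<phi> t")
      case True
      then obtain u where u: "u \<in> nodes" "?Q t u" unfolding dominated_def by blast
      have "wt (\<phi> t) = ?g t u" using u(2) by simp
      also have "\<dots> \<le> (\<Sum>u\<in>nodes. ?g t u)"
        by (rule member_le_sum[OF u(1) _ finite_nodes]) (rule g0)
      finally show ?thesis using True by (simp only: if_True simp_thms)
    next
      case False
      then show ?thesis using sum_nonneg[of nodes "?g t"] g0 by (simp only: if_False)
    qed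
  qed
  also have "\<dots> = (\<Sum>u\<in>nodes. \<Sum>t<num_present. ?g t u)"
    by (rule sum.swap)
  also have "\<dots> \<le> (\<Sum>u\<in>nodes. wt u / real d)"
  proof (rule sum_mono)
    fix u assume "u \<in> nodes"
    let ?T = "{t\<in>{..<num_present}. ?Q t u}"
    have "t = t'" if t: "t \<in> ?T" "t' \<in> ?T" for t t'
    proof (rule ccontr)
      assume "t \<noteq> t'"
      then consider "t < t'" | "t' < t" by linarith
      then show False
        using t eligible_blocked[OF a \<phi>, of t t' u] eligible_blocked[OF a \<phi>, of t' t u] by cases auto
    qed
    then have T: "card ?T \<le> 1"
      by (simp add: card_le_Suc0_iff_eq)
    have "(\<Sum>t<num_present. ?g t u) = (\<Sum>t\<in>?T. wt (\<phi> t))"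
      by (rule sum_if_filter) simp
    also have "\<dots> \<le> (\<Sum>t\<in>?T. wt u / real d)"
      using arrivals_nodes[OF \<phi>] by (intro sum_mono wt_strict_prefix) (auto simp: nodes_iff)
    also have "\<dots> = real (card ?T) * (wt u / real d)" by simp
    also have "\<dots> \<le> 1 * (wt u / real d)"
      using T wt_pos[of u] by (intro mult_right_mono) auto
    finally show "(\<Sum>t<num_present. ?g t u) \<le> wt u / real d" by simp
  qed
  also have "\<dots> = real h * leaves / real d"
    by (simp add: sum_wt_nodes flip: sum_divide_distrib)
  also have "\<dots> = leaves / real h" by (simp add: d_eq)
  finally show ?thesis .
qed

definition hits :: "(observation list \<Rightarrow> bool) \<Rightarrow> nat \<Rightarrow> nat list \<Rightarrow> (nat \<Rightarrow> nat list) set" where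
  "hits a t l = {\<phi>\<in>arrivals. prefix (\<phi> t) l \<and> eligible a \<phi> t (\<phi> t) \<and> \<not> dominated a \<phi> t}"

text \<open>Two candidates on the path to \<open>l\<close> are comparable. With the same history the
  upper one is eligible for both sequences, so the lower one would be dominated.\<close>

lemma hits_determined:
  assumes "\<phi> \<in> hits a t l" "\<psi> \<in> hits a t l" "\<And>s. s < t \<Longrightarrow> \<phi> s = \<psi> s" "t < num_present"
  shows "\<phi> t = \<psi> t"
proof (rule ccontr)
  assume ne: "\<phi> t \<noteq> \<psi> t"
  have "eligible a \<psi> t (\<phi> t)" "eligible a \<phi> t (\<psi> t)"
    using assms eligible_cong[of t \<phi> \<psi>] by (auto simp: hits_def)
  moreover have "comparable (\<phi> t) (\<psi> t)"
    using prefixes_comparable[of "\<phi> t" l "\<psi> t"] ne assms by (auto simp: hits_def)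
  moreover have "\<phi> t \<in> nodes" "\<psi> t \<in> nodes"
    using assms arrivals_nodes by (auto simp: hits_def)
  ultimately show False
    using assms unfolding hits_def dominated_def comparable_def by blast
qed

text \<open>The two nodes are siblings, so the number of present children of every parent is
  unchanged.\<close>

lemma present_exchange:
  assumes R: "R \<in> present_sets" and v: "v \<in> R" and v': "v' \<in> children (butlast v)" "v' \<notin> R"
  shows "insert v' (R - {v}) \<in> present_sets"
proof -
  have vn: "v \<in> nodes" using R v by (auto simp: present_sets_def)
  note p = node_parent[OF vn]
  have "card (insert v' (R - {v}) \<inter> children q) = h" if q: "q \<in> parents" for q
  proof (cases "q = butlast v")
    case True
    have "insert v' (R - {v}) \<inter> children q = insert v' ((R \<inter> children q) - {v})"
      using v' True by auto
    also have "card \<dots> = Suc (card ((R \<inter> children q) - {v}))"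
      using v' by (subst card_insert_disjoint) auto
    also have "\<dots> = card (R \<inter> children q)"
      using v p True by (intro card_Suc_Diff1) auto
    also have "\<dots> = h" using R q by (simp add: present_sets_def)
    finally show ?thesis .
  next
    case False
    then have "insert v' (R - {v}) \<inter> children q = R \<inter> children q"
      using v' p by (auto simp: mem_children_iff)
    then show ?thesis using R q by (simp add: present_sets_def)
  qed
  moreover have "insert v' (R - {v}) \<subseteq> nodes"
    using R v' children_nodes[OF p(1)] by (auto simp: present_sets_def)
  ultimately show ?thesis by (simp add: present_sets_def)
qed

lemma arrivals_transpose:
  assumes "\<phi> \<in> arrivals" "t < num_present" "t' < num_present"
  shows "\<phi> \<circ> Transposition.transpose t t' \<in> arrivals"
proof -
  let ?\<tau> = "Transposition.transpose t t'"
  have im: "?\<tau> ` {..<num_present} = {..<num_present}"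
    using assms by (intro permutes_image permutes_swap_id) auto
  have "inj_on (\<phi> \<circ> ?\<tau>) {..<num_present}"
    using assms im by (intro comp_inj_on) (auto simp: arrivals_def intro: inj_on_subset[OF inj_transpose])
  moreover have "(\<phi> \<circ> ?\<tau>) ` {..<num_present} = \<phi> ` {..<num_present}"
    by (simp only: image_comp[symmetric] im)
  moreover have "\<phi> \<circ> ?\<tau> \<in> extensional {..<num_present}"
    using assms by (auto simp: arrivals_def extensional_def Transposition.transpose_def)
  ultimately show ?thesis using assms(1) by (simp add: arrivals_def)
qed

lemma arrivals_replace:
  assumes \<phi>: "\<phi> \<in> arrivals" and t: "t < num_present"
    and v': "v' \<in> children (butlast (\<phi> t)) - \<phi> ` {..<num_present}"
  shows "\<phi>(t := v') \<in> arrivals"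
proof -
  have inj: "inj_on \<phi> {..<num_present}" using \<phi> by (simp add: arrivals_def)
  have im: "(\<phi>(t := v')) ` {..<num_present} = insert v' (\<phi> ` {..<num_present} - {\<phi> t})"
    using t arrivals_inj[OF \<phi>] by (auto simp: image_iff)
  have "inj_on (\<phi>(t := v')) {..<num_present}"
    using inj v' by (intro inj_on_fun_updI) auto
  moreover have "insert v' (\<phi> ` {..<num_present} - {\<phi> t}) \<in> present_sets"
    using \<phi> t v' by (intro present_exchange) (auto simp: arrivals_def)
  moreover have "\<phi>(t := v') \<in> extensional {..<num_present}"
    using \<phi> t by (auto simp: arrivals_def extensional_def)
  ultimately show ?thesis unfolding arrivals_def by (simp only: mem_Collect_eq im simp_thms)
qed

text \<open>Exchange argument: a node of the path to \<open>l\<close> that arrives at time \<open>t\<close> could be absent in favour of any of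
  its \<open>d - h\<close> absent siblings, arriving at any time from \<open>t\<close> on. The history before \<open>t\<close>, which
  determines the node, does not change, so every result arises at most \<open>h\<close> times.\<close>

lemma card_hits_le:
  assumes t: "t < num_present"
  shows "card (hits a t l) * ((d - h) * (num_present - t)) \<le> h * card arrivals"
proof -
  \<comment> \<open>The triples consist of a hit, an absent sibling \<open>v'\<close> of the node
    arriving at time \<open>t\<close>, and a new arrival time \<open>t'\<close> from
    \<open>t\<close> on.\<close>
  let ?X = "SIGMA \<phi>:hits a t l. (children (butlast (\<phi> t)) - \<phi> ` {..<num_present}) \<times> {t..<num_present}"
  let ?F = "\<lambda>(\<phi>, v', t'). \<phi>(t := v') \<circ> Transposition.transpose t t'"
  have fh: "finite (hits a t l)" using finite_arrivals by (auto simp: hits_def)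
  have "card ?X = (\<Sum>\<phi>\<in>hits a t l. card ((children (butlast (\<phi> t)) - \<phi> ` {..<num_present}) \<times> {t..<num_present}))"
    using fh by (intro card_SigmaI) auto
  also have "\<dots> = (\<Sum>\<phi>\<in>hits a t l. (d - h) * (num_present - t))"
  proof (rule sum.cong[OF refl])
    fix \<phi> assume "\<phi> \<in> hits a t l"
    then have \<phi>: "\<phi> \<in> arrivals" by (simp add: hits_def)
    let ?q = "butlast (\<phi> t)"
    have "?q \<in> parents" using node_parent arrivals_nodes[OF \<phi> t] by blast
    then have "card (\<phi> ` {..<num_present} \<inter> children ?q) = h"
      using \<phi> by (auto simp: arrivals_def present_sets_def)
    moreover have "children ?q - \<phi> ` {..<num_present} = children ?q - (\<phi> ` {..<num_present} \<inter> children ?q)"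
      by auto
    ultimately have "card (children ?q - \<phi> ` {..<num_present}) = d - h"
      by (simp add: card_Diff_subset card_children)
    then show "card ((children ?q - \<phi> ` {..<num_present}) \<times> {t..<num_present}) = (d - h) * (num_present - t)"
      by (simp add: card_cartesian_product)
  qed
  finally have "card ?X = card (hits a t l) * ((d - h) * (num_present - t))" by simp
  moreover have "card ?X \<le> h * card arrivals"
  proof (rule card_le_fibers[where F = ?F])
    show "finite ?X" using fh by auto
    show "finite arrivals" by (rule finite_arrivals)
    show "?F ` ?X \<subseteq> arrivals"
      using t by (auto simp: hits_def intro!: arrivals_transpose arrivals_replace)
    fix \<psi> assume \<psi>: "\<psi> \<in> arrivals"
    let ?Y = "{x\<in>?X. ?F x = \<psi>}"
    show "card ?Y \<le> h"
    proof (cases "?Y = {}")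
      case True
      then show ?thesis by (simp only: card.empty)
    next
      case False
      \<comment> \<open>Since \<open>t \<le> t'\<close>, neither the replacement nor the
        transposition touches the times before \<open>t\<close>.\<close>
      have prefix_eq: "\<phi> s = \<psi> s" if "(\<phi>, v', t') \<in> ?Y" "s < t" for \<phi> v' t' s
      proof -
        have "\<phi>(t := v') \<circ> Transposition.transpose t t' = \<psi>" "t \<le> t'" using that(1) by auto
        then have "\<psi> s = (\<phi>(t := v')) (Transposition.transpose t t' s)" "s \<noteq> t" "s \<noteq> t'"
          using that(2) by auto
        then show ?thesis by (simp add: transpose_apply_other)
      qed
      from False obtain \<phi>0 v0 t0 where y0: "(\<phi>0, v0, t0) \<in> ?Y" by auto
      then have \<phi>0: "\<phi>0 \<in> hits a t l" by auto
      \<comment> \<open>The history fixes the replaced node, so the hit can be reconstructed from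
        \<open>\<psi>\<close> and \<open>t'\<close> by undoing the two moves.\<close>
      have Y: "\<phi> t = \<phi>0 t" "v' = \<psi> t'" "t' < num_present" "v' \<in> children (butlast (\<phi>0 t))"
        "\<phi> = (\<psi> \<circ> Transposition.transpose t t')(t := \<phi>0 t)"
        if y: "(\<phi>, v', t') \<in> ?Y" for \<phi> v' t'
      proof -
        have \<phi>: "\<phi> \<in> hits a t l" "v' \<in> children (butlast (\<phi> t))" "t \<le> t'" "t' < num_present"
          and eq: "\<phi>(t := v') \<circ> Transposition.transpose t t' = \<psi>" using y by auto
        show 1: "\<phi> t = \<phi>0 t"
          using prefix_eq[OF y] prefix_eq[OF y0] by (intro hits_determined[OF \<phi>(1) \<phi>0 _ t]) simp
        show "v' = \<psi> t'" using fun_cong[OF eq, of t'] by simp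
        show "t' < num_present" by fact
        show "v' \<in> children (butlast (\<phi>0 t))" using \<phi>(2) 1 by simp
        have "\<psi> \<circ> Transposition.transpose t t' = \<phi>(t := v')"
          by (simp add: eq[symmetric] comp_assoc)
        then show "\<phi> = (\<psi> \<circ> Transposition.transpose t t')(t := \<phi>0 t)" using 1 by (simp add: fun_eq_iff)
      qed
      let ?C = "\<psi> ` {..<num_present} \<inter> children (butlast (\<phi>0 t))"
      \<comment> \<open>The sibling \<open>v'\<close> alone identifies the triple: its position in
        \<open>\<psi>\<close> is \<open>t'\<close>. It is one of the \<open>h\<close> present
        children of a fixed parent.\<close>
      have "inj_on (\<lambda>(\<phi>, v', t'). v') ?Y"
      proof (rule inj_onI)
        fix x y assume xy: "x \<in> ?Y" "y \<in> ?Y" "(\<lambda>(\<phi>, v', t'). v') x = (\<lambda>(\<phi>, v', t'). v') y"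
        obtain \<phi>1 v1 t1 \<phi>2 v2 t2 where x: "x = (\<phi>1, v1, t1)" and y: "y = (\<phi>2, v2, t2)"
          by (metis prod_cases3)
        note Yx = Y[OF xy(1)[unfolded x]] and Yy = Y[OF xy(2)[unfolded y]]
        have v: "v1 = v2" using xy(3) by (simp add: x y)
        have "\<psi> t1 = \<psi> t2" using Yx(2) Yy(2) v by simp
        then have "t1 = t2" using arrivals_inj[OF \<psi> Yx(3) Yy(3)] by simp
        then show "x = y" using Yx(5) Yy(5) v by (simp add: x y)
      qed
      moreover have "(\<lambda>(\<phi>, v', t'). v') ` ?Y \<subseteq> ?C"
      proof
        fix z assume "z \<in> (\<lambda>(\<phi>, v', t'). v') ` ?Y"
        then obtain \<phi> t' where y: "(\<phi>, z, t') \<in> ?Y" by auto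
        show "z \<in> ?C" using Y(2-4)[OF y] by auto
      qed
      ultimately have "card ?Y \<le> card ?C" by (intro card_inj_on_le) auto
      also have "card ?C = h"
        using \<psi> node_parent(1)[OF arrivals_nodes[of \<phi>0 t]] \<phi>0 t
        by (auto simp: arrivals_def present_sets_def hits_def)
      finally show ?thesis .
    qed
  qed
  ultimately show ?thesis by simp
qed

text \<open>Transposing two arrival times shows that all times have the same average weight, and the
  weights of one instance add up to \<open>leaves\<close>.\<close>

lemma sum_arrival_wt:
  assumes t: "t < num_present"
  shows "real num_present * (\<Sum>\<phi>\<in>arrivals. wt (\<phi> t)) = leaves * real (card arrivals)"
proof -
  have "(\<Sum>\<phi>\<in>arrivals. wt (\<phi> t')) = (\<Sum>\<phi>\<in>arrivals. wt (\<phi> t))" if t': "t' < num_present" for t'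
  proof (rule sum.reindex_bij_witness[where i = "\<lambda>\<phi>. \<phi> \<circ> Transposition.transpose t t'" and j = "\<lambda>\<phi>. \<phi> \<circ> Transposition.transpose t t'"])
    fix \<phi> assume \<phi>: "\<phi> \<in> arrivals"
    show "\<phi> \<circ> Transposition.transpose t t' \<circ> Transposition.transpose t t' = \<phi>" by (simp add: comp_assoc)
    then show "\<phi> \<circ> Transposition.transpose t t' \<circ> Transposition.transpose t t' = \<phi>" .
    show "\<phi> \<circ> Transposition.transpose t t' \<in> arrivals" using arrivals_transpose[OF \<phi> t t'] .
    then show "\<phi> \<circ> Transposition.transpose t t' \<in> arrivals" .
    show "wt ((\<phi> \<circ> Transposition.transpose t t') t) = wt (\<phi> t')" by simp
  qed
  then have "real num_present * (\<Sum>\<phi>\<in>arrivals. wt (\<phi> t)) = (\<Sum>t'<num_present. \<Sum>\<phi>\<in>arrivals. wt (\<phi> t'))"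
    by simp
  also have "\<dots> = (\<Sum>\<phi>\<in>arrivals. \<Sum>t'<num_present. wt (\<phi> t'))"
    by (rule sum.swap)
  also have "\<dots> = (\<Sum>\<phi>\<in>arrivals. leaves)"
  proof (rule sum.cong[OF refl])
    fix \<phi> assume \<phi>: "\<phi> \<in> arrivals"
    then have "(\<Sum>t'<num_present. wt (\<phi> t')) = (\<Sum>v\<in>\<phi> ` {..<num_present}. wt v)"
      by (subst sum.reindex) (auto simp: arrivals_def)
    also have "\<dots> = leaves" using \<phi> by (intro sum_wt_present) (simp add: arrivals_def)
    finally show "(\<Sum>t'<num_present. wt (\<phi> t')) = leaves" .
  qed
  finally show ?thesis by simp
qed

text \<open>The weight of a node is spread over the leaves below it, so the exchange bound can be
  applied to each leaf separately.\<close>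

lemma sum_hits_eq:
  assumes t: "t < num_present"
  shows "(\<Sum>\<phi>\<in>arrivals. if eligible a \<phi> t (\<phi> t) \<and> \<not> dominated a \<phi> t then wt (\<phi> t) else 0)
    = (\<Sum>l\<in>words h. real (card (hits a t l)))"
proof -
  let ?Q = "\<lambda>\<phi>. eligible a \<phi> t (\<phi> t) \<and> \<not> dominated a \<phi> t"
  have "(\<Sum>\<phi>\<in>arrivals. if ?Q \<phi> then wt (\<phi> t) else 0)
      = (\<Sum>\<phi>\<in>arrivals. \<Sum>l\<in>words h. if prefix (\<phi> t) l \<and> ?Q \<phi> then 1 else 0)"
  proof (rule sum.cong[OF refl])
    fix \<phi> assume \<phi>: "\<phi> \<in> arrivals"
    have "wt (\<phi> t) = real (card {l\<in>words h. prefix (\<phi> t) l})"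
      using arrivals_nodes[OF \<phi> t] by (intro wt_eq_card) (auto simp: nodes_iff)
    then show "(if ?Q \<phi> then wt (\<phi> t) else 0) = (\<Sum>l\<in>words h. if prefix (\<phi> t) l \<and> ?Q \<phi> then 1 else 0)"
      by (cases "?Q \<phi>") (simp_all add: sum_if_const)
  qed
  also have "\<dots> = (\<Sum>l\<in>words h. \<Sum>\<phi>\<in>arrivals. if prefix (\<phi> t) l \<and> ?Q \<phi> then 1 else 0)"
    by (rule sum.swap)
  also have "\<dots> = (\<Sum>l\<in>words h. real (card (hits a t l)))"
    using finite_arrivals by (simp add: sum_if_const hits_def)
  finally show ?thesis .
qed

lemma num_present_ge: "h \<le> num_present"
proof -
  have "[] \<in> parents" using h2 by (simp add: parents_iff)
  then have "card parents \<ge> 1" by (auto simp: Suc_le_eq card_gt_0_iff)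
  then show ?thesis by (simp add: num_present_def)
qed

text \<open>Three contributions: dominated acceptances, undominated ones before the last
  \<open>M\<close> arrivals, and these last arrivals, counted in full whether accepted or
  not.\<close>

lemma sum_collected_le:
  assumes a: "feasible_rule a"
  shows "(\<Sum>\<phi>\<in>arrivals. collected a \<phi>)
    \<le> leaves * (2 / real h + ln (2 * real h) / (real h - 1)) * real (card arrivals)"
proof -
  \<comment> \<open>The bound at time \<open>t\<close> is proportional to
    \<open>1 / (num_present - t)\<close>. Leaving out about a fraction \<open>1 / h\<close> of the
    arrivals keeps its sum of order \<open>ln h\<close>.\<close>
  define M where "M = num_present div h"
  define c where "c = leaves * real (card arrivals)"
  let ?Q = "\<lambda>\<phi> t. eligible a \<phi> t (\<phi> t)"
  have h: "real h > 1" using h2 by simp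
  \<comment> \<open>The factor \<open>2\<close> absorbs the rounding of the division and becomes the
    \<open>2\<close> inside the logarithm.\<close>
  have M: "1 \<le> M" "M \<le> num_present" "M * h \<le> num_present" "num_present \<le> 2 * h * M"
  proof -
    show 1: "1 \<le> M" unfolding M_def using num_present_ge h2 by (simp add: div_greater_zero_iff Suc_le_eq)
    show "M \<le> num_present" by (simp add: M_def)
    show "M * h \<le> num_present" unfolding M_def by simp
    have "num_present mod h < h" using h2 by simp
    moreover have "num_present = M * h + num_present mod h" unfolding M_def by simp
    moreover have "h \<le> M * h" using 1 by simp
    ultimately have "num_present \<le> M * h + M * h" by linarith
    then show "num_present \<le> 2 * h * M" by (simp add: algebra_simps)
  qed
  have c0: "0 \<le> c" unfolding c_def by simp
  let ?D = "\<lambda>\<phi>. \<Sum>t<num_present. if ?Q \<phi> t \<and> dominated a \<phi> t then wt (\<phi> t) else 0"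
  let ?E = "\<lambda>\<phi>. \<Sum>t<num_present - M. if ?Q \<phi> t \<and> \<not> dominated a \<phi> t then wt (\<phi> t) else 0"
  let ?L = "\<lambda>\<phi>. \<Sum>t\<in>{num_present - M..<num_present}. wt (\<phi> t)"
  have split: "collected a \<phi> \<le> ?D \<phi> + ?E \<phi> + ?L \<phi>" if \<phi>: "\<phi> \<in> arrivals" for \<phi>
  proof -
    let ?e = "\<lambda>t. if ?Q \<phi> t \<and> \<not> dominated a \<phi> t then wt (\<phi> t) else 0"
    have "collected a \<phi> = (\<Sum>t<num_present. (if ?Q \<phi> t \<and> dominated a \<phi> t then wt (\<phi> t) else 0) + ?e t)"
      unfolding collected_def using accepts_iff_eligible[OF \<phi>]
      by (intro sum.cong) (auto simp del: upt_Suc)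
    also have "\<dots> = ?D \<phi> + (\<Sum>t<num_present. ?e t)" by (rule sum.distrib)
    also have "(\<Sum>t<num_present. ?e t) = ?E \<phi> + (\<Sum>t\<in>{num_present - M..<num_present}. ?e t)"
    proof -
      have *: "{..<num_present} = {..<num_present - M} \<union> {num_present - M..<num_present}" by auto
      show ?thesis by (subst *) (rule sum.union_disjoint, auto)
    qed
    also have "(\<Sum>t\<in>{num_present - M..<num_present}. ?e t) \<le> ?L \<phi>"
      using wt_pos by (intro sum_mono) (simp add: less_imp_le)
    finally show ?thesis by simp
  qed
  have D: "(\<Sum>\<phi>\<in>arrivals. ?D \<phi>) \<le> c / real h"
  proof -
    have "(\<Sum>\<phi>\<in>arrivals. ?D \<phi>) \<le> (\<Sum>\<phi>\<in>arrivals. leaves / real h)"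
      by (intro sum_mono dominated_collected_le a)
    then show ?thesis by (simp add: c_def mult.commute)
  qed
  have E: "(\<Sum>\<phi>\<in>arrivals. ?E \<phi>) \<le> c / (real h - 1) * ln (2 * real h)"
  proof -
    have "(\<Sum>\<phi>\<in>arrivals. ?E \<phi>) = (\<Sum>t<num_present - M. \<Sum>l\<in>words h. real (card (hits a t l)))"
      by (subst sum.swap) (auto intro!: sum.cong sum_hits_eq)
    also have "\<dots> \<le> (\<Sum>t<num_present - M. \<Sum>l\<in>words h.
        real (card arrivals) / (real h - 1) * (1 / real (num_present - t)))"
    proof (intro sum_mono)
      fix t l assume "t \<in> {..<num_present - M}"
      then have t: "t < num_present" by auto
      let ?r = "real (card (hits a t l))"
      have "?r * (real (d - h) * real (num_present - t)) \<le> real h * real (card arrivals)"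
        using card_hits_le[OF t, of a l] by (simp only: of_nat_mult[symmetric] of_nat_le_iff)
      \<comment> \<open>With \<open>d = h * h\<close> the ratio \<open>h / (d - h)\<close> is
        \<open>1 / (h - 1)\<close>, the factor for being present given the history.\<close>
      moreover have "real (d - h) = real h * (real h - 1)"
        using h_less_d by (simp add: of_nat_diff less_imp_le) (simp add: d_eq algebra_simps)
      ultimately have "real h * (?r * ((real h - 1) * real (num_present - t))) \<le> real h * real (card arrivals)"
        by (simp only: ac_simps)
      then have "?r * ((real h - 1) * real (num_present - t)) \<le> real (card arrivals)"
        using h by (simp del: of_nat_diff)
      then show "?r \<le> real (card arrivals) / (real h - 1) * (1 / real (num_present - t))"
        using h t by (simp add: pos_le_divide_eq del: of_nat_diff)
    qed
    also have "\<dots> = c / (real h - 1) * (\<Sum>t<num_present - M. 1 / real (num_present - t))"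
      by (simp add: card_words c_def sum_distrib_left del: of_nat_diff)
    also have "\<dots> \<le> c / (real h - 1) * ln (2 * real h)"
    proof (rule mult_left_mono)
      have "real num_present / real M \<le> 2 * real h"
        using M(1,4) by (simp add: pos_divide_le_eq) (metis of_nat_le_iff of_nat_mult of_nat_numeral)
      then have "ln (real num_present / real M) \<le> ln (2 * real h)"
        using M h by (intro ln_mono) auto
      then show "(\<Sum>t<num_present - M. 1 / real (num_present - t)) \<le> ln (2 * real h)"
        using harmonic_tail_le[OF M(1,2)] by linarith
    qed (use c0 h in simp)
    finally show ?thesis .
  qed
  have L: "(\<Sum>\<phi>\<in>arrivals. ?L \<phi>) \<le> c / real h"
  proof -
    have N0: "real num_present > 0" using M by linarith
    have "(\<Sum>\<phi>\<in>arrivals. ?L \<phi>) = (\<Sum>t\<in>{num_present - M..<num_present}. \<Sum>\<phi>\<in>arrivals. wt (\<phi> t))"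
      by (rule sum.swap)
    also have "\<dots> = (\<Sum>t\<in>{num_present - M..<num_present}. c / real num_present)"
      using sum_arrival_wt N0 by (intro sum.cong) (auto simp: c_def field_simps)
    also have "\<dots> = real M * c / real num_present" using M by simp
    also have "\<dots> \<le> c / real h"
    proof -
      have "real M * real h \<le> real num_present"
        using M(3) by (simp only: of_nat_mult[symmetric] of_nat_le_iff)
      then have "(real M * real h) * c \<le> real num_present * c" using c0 by (rule mult_right_mono)
      then show ?thesis using N0 h by (simp add: field_simps)
    qed
    finally show ?thesis .
  qed
  have "(\<Sum>\<phi>\<in>arrivals. collected a \<phi>) \<le> (\<Sum>\<phi>\<in>arrivals. ?D \<phi> + ?E \<phi> + ?L \<phi>)"
    by (rule sum_mono) (rule split)
  also have "\<dots> = (\<Sum>\<phi>\<in>arrivals. ?D \<phi>) + (\<Sum>\<phi>\<in>arrivals. ?E \<phi>) + (\<Sum>\<phi>\<in>arrivals. ?L \<phi>)"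
    by (simp only: sum.distrib)
  also have "\<dots> \<le> c / real h + c / (real h - 1) * ln (2 * real h) + c / real h"
    using D E L by linarith
  also have "\<dots> = c * (2 / real h + ln (2 * real h) / (real h - 1))"
    by (simp add: algebra_simps add_divide_distrib)
  finally show ?thesis by (simp add: c_def mult_ac)
qed

text \<open>The sequences are grouped by their set of nodes. An isomorphism from
  \<open>base_set\<close> carries the orders of each group to permutations with the same
  observations.\<close>

lemma sum_arrivals:
  fixes G :: "observation list \<Rightarrow> real"
  assumes c: "bij_betw c {..<num_present} base_set"
  shows "(\<Sum>\<phi>\<in>arrivals. G (map (arrival_obs \<phi>) [0..<num_present]))
    = real (card present_sets) *
      (\<Sum>\<pi>\<in>{\<pi>. \<pi> permutes {..<num_present}}. G (map (arrival_obs (c \<circ> \<pi>)) [0..<num_present]))"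
proof -
  let ?B = "\<lambda>R. {\<phi> \<in> extensional {..<num_present}. bij_betw \<phi> {..<num_present} R}"
  let ?S = "\<Sum>\<pi>\<in>{\<pi>. \<pi> permutes {..<num_present}}. G (map (arrival_obs (c \<circ> \<pi>)) [0..<num_present])"
  have U: "arrivals = (\<Union>R\<in>present_sets. ?B R)"
    by (auto simp: arrivals_def bij_betw_def)
  then have fin: "finite (?B R)" if "R \<in> present_sets" for R
    using finite_subset[OF _ finite_arrivals, of "?B R"] that by blast
  have "(\<Sum>\<phi>\<in>arrivals. G (map (arrival_obs \<phi>) [0..<num_present]))
      = (\<Sum>R\<in>present_sets. \<Sum>\<phi>\<in>?B R. G (map (arrival_obs \<phi>) [0..<num_present]))"
    unfolding U using fin finite_present_sets
    by (intro sum.UNION_disjoint) (auto simp: bij_betw_def)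
  also have "\<dots> = (\<Sum>R\<in>present_sets. ?S)"
  proof (rule sum.cong[OF refl])
    fix R assume R: "R \<in> present_sets"
    obtain g where g: "bij_betw g base_set R" "\<And>x. x \<in> base_set \<Longrightarrow> length (g x) = length x"
      "\<And>x y. x \<in> base_set \<Longrightarrow> y \<in> base_set \<Longrightarrow> comparable (g x) (g y) \<longleftrightarrow> comparable x y"
      using present_isomorphic[OF R] by metis
    let ?r = "\<lambda>\<pi>. restrict (g \<circ> c \<circ> \<pi>) {..<num_present}"
    have "(\<Sum>\<phi>\<in>?B R. G (map (arrival_obs \<phi>) [0..<num_present]))
        = (\<Sum>\<pi>\<in>{\<pi>. \<pi> permutes {..<num_present}}. G (map (arrival_obs (?r \<pi>)) [0..<num_present]))"
      by (rule sum.reindex_bij_betw[OF bij_betw_compose_permutations[OF bij_betw_trans[OF c g(1)]], symmetric])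
    also have "\<dots> = ?S"
    proof (rule sum.cong[OF refl])
      fix \<pi> assume "\<pi> \<in> {\<pi>. \<pi> permutes {..<num_present}}"
      then have "c (\<pi> t) \<in> base_set" if "t < num_present" for t
        using bij_betwE[OF c] permutes_in_image[of \<pi> "{..<num_present}" t] that by auto
      then have "arrival_obs (?r \<pi>) t = arrival_obs (c \<circ> \<pi>) t" if "t < num_present" for t
        using that g(2,3) by (auto simp: arrival_obs_def wt_def)
      then have "map (arrival_obs (?r \<pi>)) [0..<num_present] = map (arrival_obs (c \<circ> \<pi>)) [0..<num_present]"
        by (intro map_cong) auto
      then show "G (map (arrival_obs (?r \<pi>)) [0..<num_present])
          = G (map (arrival_obs (c \<circ> \<pi>)) [0..<num_present])"
        by (simp only:)
    qed
    finally show "(\<Sum>\<phi>\<in>?B R. G (map (arrival_obs \<phi>) [0..<num_present])) = ?S" .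
  qed
  finally show ?thesis by simp
qed

lemma sum_permutations_le:
  assumes c: "bij_betw c {..<num_present} base_set" and A: "feasible_rule (A r)"
  shows "(\<Sum>\<pi>\<in>{\<pi>. \<pi> permutes {..<num_present}}. ALG A r (map (arrival_obs (c \<circ> \<pi>)) [0..<num_present]))
    \<le> leaves * (2 / real h + ln (2 * real h) / (real h - 1)) * real (card {\<pi>. \<pi> permutes {..<num_present}})"
    (is "?S \<le> ?b * real (card ?P)")
proof -
  have p: "real (card present_sets) > 0"
    using base_present finite_present_sets by (auto simp: card_gt_0_iff)
  have "ALG A r (map (arrival_obs \<phi>) [0..<num_present]) = collected (A r) \<phi>" for \<phi>
  proof -
    have "fst (arrival_obs \<phi> t) = wt (\<phi> t)" for t by (simp add: arrival_obs_def)
    then show ?thesis by (simp only: ALG_map_upt collected_def)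
  qed
  then have "real (card present_sets) * ?S = (\<Sum>\<phi>\<in>arrivals. collected (A r) \<phi>)"
    using sum_arrivals[OF c, of "ALG A r"] by simp
  also have "\<dots> \<le> ?b * real (card arrivals)"
    by (rule sum_collected_le[OF A])
  \<comment> \<open>The constant function \<open>1\<close> turns the identity of sums into the count
    of \<open>arrivals\<close>.\<close>
  also have "real (card arrivals) = real (card present_sets) * real (card ?P)"
    using sum_arrivals[OF c, of "\<lambda>_. 1"] by simp
  finally have "real (card present_sets) * ?S \<le> real (card present_sets) * (?b * real (card ?P))"
    by (simp only: ac_simps)
  then show ?thesis using p by (simp only: mult_le_cancel_left_pos)
qed

section \<open>The optimum and the random order of the fixed secretary instance\<close>

lemma base_uncovered_le:
  "2 * card {l\<in>words h. \<not> (\<exists>v\<in>base_set. prefix v l)} \<le> d ^ h"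
proof -
  \<comment> \<open>A letter below \<open>h\<close> ends a prefix that lies in
    \<open>base_set\<close>, so an uncovered leaf uses only letters from \<open>h\<close>
    on.\<close>
  have "{l\<in>words h. \<not> (\<exists>v\<in>base_set. prefix v l)} \<subseteq> {l. set l \<subseteq> {h..<d} \<and> length l = h}"
  proof safe
    fix l k assume l: "l \<in> words h" "\<not> (\<exists>v\<in>base_set. prefix v l)" and k: "k \<in> set l"
    have "\<not> k < h"
    proof
      assume "k < h"
      obtain i where i: "i < length l" "l ! i = k" using k by (auto simp: in_set_conv_nth)
      have "take (Suc i) l \<in> base_set"
        using l(1) i \<open>k < h\<close> k
        by (auto simp: base_set_def nodes_iff words_def take_Suc_conv_app_nth dest: in_set_takeD)
      then show False using l(2) take_is_prefix by blast
    qed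
    then show "k \<in> {h..<d}" using l(1) k by (auto simp: words_def)
  qed (simp add: words_def)
  then have "card {l\<in>words h. \<not> (\<exists>v\<in>base_set. prefix v l)} \<le> card {l. set l \<subseteq> {h..<d} \<and> length l = h}"
    by (intro card_mono finite_lists_length_eq) auto
  also have "\<dots> = (d - h) ^ h"
    by (simp add: card_lists_length_eq)
  \<comment> \<open>The uncovered share of the leaves is thus at most
    \<open>(1 - 1 / h) ^ h\<close>, the same as for prophets.\<close>
  also have "d - h = h * (h - 1)"
    by (simp add: d_eq diff_mult_distrib2)
  finally have "2 * card {l\<in>words h. \<not> (\<exists>v\<in>base_set. prefix v l)} \<le> h ^ h * (2 * (h - 1) ^ h)"
    by (simp add: power_mult_distrib)
  also have "\<dots> \<le> h ^ h * h ^ h"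
    using two_power_le[OF h2] by (rule mult_le_mono2)
  finally show ?thesis by (simp add: d_eq power_mult_distrib)
qed

lemma base_OPT_ge:
  assumes c: "bij_betw c {..<num_present} base_set"
  shows "leaves / 2 \<le> OPT {..<num_present} (\<lambda>u v. comparable (c u) (c v)) (\<lambda>v. wt (c v))"
proof -
  let ?C = "\<lambda>l. \<exists>v\<in>base_set. prefix v l"
  let ?T = "{v\<in>base_set. \<forall>u\<in>base_set. \<not> strict_prefix u v}"
  let ?S = "{i\<in>{..<num_present}. c i \<in> ?T}"
  have "card (words h) = card {l\<in>words h. ?C l} + card {l\<in>words h. \<not> ?C l}"
    by (subst card_Un_disjoint[symmetric]) (auto intro!: arg_cong[of _ _ card])
  then have "d ^ h \<le> 2 * card {l\<in>words h. ?C l}"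
    using base_uncovered_le by (simp add: card_words)
  then have "leaves \<le> real (2 * card {l\<in>words h. ?C l})"
    by (simp only: of_nat_power[symmetric] of_nat_le_iff)
  then have "leaves / 2 \<le> real (card {l\<in>words h. ?C l})" by simp
  also have "\<dots> \<le> (\<Sum>v\<in>?T. wt v)"
    by (rule roots_wt_ge) (auto simp: base_set_def)
  also have "\<dots> = (\<Sum>i\<in>?S. wt (c i))"
  proof (rule sum.reindex_bij_betw[symmetric])
    show "bij_betw c ?S ?T"
      using c unfolding bij_betw_def by (auto simp: inj_on_def)
  qed
  also have "\<dots> \<le> OPT {..<num_present} (\<lambda>u v. comparable (c u) (c v)) (\<lambda>v. wt (c v))"
    using bij_betwE[OF c]
    by (intro OPT_ge) (auto simp: independent_set_def comparable_def)
  finally show ?thesis .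
qed

lemma secretary_ALG_le:
  assumes c: "bij_betw c {..<num_present} base_set" and A: "online_algorithm R A"
  shows "secretary_ALG num_present (\<lambda>u v. comparable (c u) (c v)) (\<lambda>v. wt (c v)) R A
    \<le> leaves * (2 / real h + ln (2 * real h) / (real h - 1))" (is "?lhs \<le> ?b")
proof -
  interpret prob_space R using A by (simp add: online_algorithm_def)
  let ?P = "{\<pi>. \<pi> permutes {..<num_present}}"
  let ?f = "\<lambda>\<pi> r. ALG A r (map (arrival_obs (c \<circ> \<pi>)) [0..<num_present])"
  have P: "finite ?P" "?P \<noteq> {}"
    using permutes_id[of "{..<num_present}"] by (simp add: finite_permutations, blast)
  have "observations num_present (\<lambda>u v. comparable (c u) (c v)) (\<lambda>v. wt (c v)) \<pi>
      = map (arrival_obs (c \<circ> \<pi>)) [0..<num_present]" for \<pi>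
    by (simp add: observations_def arrival_obs_def)
  then have "?lhs = (\<Sum>\<pi>\<in>?P. \<integral>r. ?f \<pi> r \<partial>R) / real (card ?P)"
    unfolding secretary_ALG_def using P by (simp add: integral_pmf_of_set)
  \<comment> \<open>The order is averaged first for a fixed seed, where the rule is
    deterministic.\<close>
  also have "(\<Sum>\<pi>\<in>?P. \<integral>r. ?f \<pi> r \<partial>R) = (\<integral>r. (\<Sum>\<pi>\<in>?P. ?f \<pi> r) \<partial>R)"
    by (rule Bochner_Integration.integral_sum[symmetric]) (rule integrable_ALG[OF A])
  also have "\<dots> \<le> ?b * real (card ?P)"
    using sum_permutations_le[OF c online_algorithm_feasible[OF A]]
    by (intro integral_le_const Bochner_Integration.integrable_sum integrable_ALG[OF A]) auto
  finally have "?lhs \<le> ?b * real (card ?P) / real (card ?P)"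
    by (simp add: divide_right_mono)
  also have "\<dots> = ?b"
    using P by (intro nonzero_mult_div_cancel_right) (simp only: card_eq_0_iff of_nat_eq_0_iff simp_thms)
  finally show ?thesis .
qed

lemma num_present_le: "num_present \<le> h * d ^ h"
  using card_present[OF base_present] card_mono[of nodes base_set] card_nodes_le
  by (auto simp: base_set_def)

lemma secretary_bound:
  assumes h3: "3 \<le> h"
  shows "\<exists>E w. secretary_instance num_present E w \<and> 0 < OPT {..<num_present} E w \<and>
    (\<forall>R A. online_algorithm R A \<longrightarrow>
      secretary_ALG num_present E w R A \<le> 12 * (ln (real h) / real h) * OPT {..<num_present} E w)"
proof -
  obtain c where c: "bij_betw c {..<num_present} base_set"
    using ex_bij_betw_nat_finite[OF finite_present[OF base_present]] card_present[OF base_present]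
    by (auto simp: atLeast0LessThan)
  let ?E = "\<lambda>u v. comparable (c u) (c v)" and ?w = "\<lambda>v. wt (c v)"
  let ?O = "OPT {..<num_present} ?E ?w"
  have O: "leaves / 2 \<le> ?O" by (rule base_OPT_ge[OF c])
  have L: "leaves > 0" using d_pos by simp
  have "interval_graph {..<num_present} ?E"
    using c bij_betwE[OF c] d_pos
    by (intro interval_graph_comparable[where d = d]) (auto simp: bij_betw_def base_set_def nodes_iff)
  then have inst: "secretary_instance num_present ?E ?w"
    using wt_pos by (simp add: secretary_instance_def less_imp_le)
  have h: "real h \<ge> 3" using h3 by simp
  have ln1: "1 \<le> ln (real h)"
    using h exp_le ln_ge_iff[of "real h" 1] by linarith
  have "ln (2 * real h) = ln 2 + ln (real h)" using h by (simp add: ln_mult)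
  also have "\<dots> \<le> 2 * ln (real h)" using h by (simp add: ln_mono)
  finally have "ln (2 * real h) / (real h - 1) \<le> 2 * ln (real h) / (real h / 2)"
    using h ln1 by (intro frac_le) auto
  moreover have "2 / real h \<le> 2 * ln (real h) / real h"
    using ln1 h by (intro divide_right_mono) auto
  \<comment> \<open>The \<open>6\<close> is \<open>2 + 4\<close>: the term \<open>2 / h\<close> is
    enlarged by \<open>ln h \<ge> 1\<close>, which holds from \<open>h = 3\<close> on, and the other
    uses \<open>h - 1 \<ge> h / 2\<close>.\<close>
  ultimately have b: "2 / real h + ln (2 * real h) / (real h - 1) \<le> 6 * (ln (real h) / real h)"
    by simp
  have "secretary_ALG num_present ?E ?w R A \<le> 12 * (ln (real h) / real h) * ?O"
    if A: "online_algorithm R A" for R A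
  proof -
    have "secretary_ALG num_present ?E ?w R A \<le> leaves * (6 * (ln (real h) / real h))"
      using secretary_ALG_le[OF c A] mult_left_mono[OF b less_imp_le[OF L]] by linarith
    \<comment> \<open>The optimum is only known to reach half of \<open>leaves\<close>, which
      doubles the constant.\<close>
    also have "\<dots> = 12 * (ln (real h) / real h) * (leaves / 2)" by simp
    also have "\<dots> \<le> 12 * (ln (real h) / real h) * ?O"
      using O ln1 h by (intro mult_left_mono) auto
    finally show ?thesis .
  qed
  moreover have "0 < ?O" using O L by linarith
  ultimately show ?thesis using inst by blast
qed

lemma prophet_bound:
  assumes h3: "3 \<le> h"
  shows "\<exists>E D \<pi>. prophet_instance (card nodes) E D \<pi> \<and> 0 < prophet_OPT (card nodes) E D \<and>
    (\<forall>R A. online_algorithm R A \<longrightarrow>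
      prophet_ALG (card nodes) E D \<pi> R A \<le> 12 * (ln (real h) / real h) * prophet_OPT (card nodes) E D)"
proof -
  obtain e where "bottom_up_tree h d (card nodes) e" by (rule bottom_up_enumeration)
  then interpret T: bottom_up_tree h d "card nodes" e .
  let ?O = "prophet_OPT (card nodes) T.adj T.node_dist"
  have L: "leaves > 0" using d_pos by simp
  have h: "real h \<ge> 3" using h3 by simp
  have ln1: "1 \<le> ln (real h)"
    using h exp_le ln_ge_iff[of "real h" 1] by linarith
  have O: "leaves / 2 \<le> ?O" by (rule T.prophet_OPT_ge)
  have "prophet_ALG (card nodes) T.adj T.node_dist id R A \<le> 12 * (ln (real h) / real h) * ?O"
    if A: "online_algorithm R A" for R A
  proof -
    have "prophet_ALG (card nodes) T.adj T.node_dist id R A \<le> 2 * leaves / real h"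
      by (rule T.prophet_ALG_le[OF A])
    also have "\<dots> = 4 / real h * (leaves / 2)" by simp
    also have "\<dots> \<le> 12 * (ln (real h) / real h) * ?O"
    proof (rule mult_mono)
      \<comment> \<open>Prophets even satisfy \<open>4 / h\<close>; it is weakened to the form of
        the secretary bound.\<close>
      show "4 / real h \<le> 12 * (ln (real h) / real h)"
        using divide_right_mono[of 4 "12 * ln (real h)" "real h"] ln1 h by simp
    qed (use O L ln1 h in auto)
    finally show ?thesis .
  qed
  moreover have "0 < ?O" using O L by linarith
  ultimately show ?thesis using T.prophet_instance_tree by blast
qed

end

section \<open>Choice of the depth \<open>h\<close> for a given number of nodes\<close>

lemma tree_parameter:
  "\<forall>\<^sub>F n :: nat in sequentially. \<exists>h\<ge>3. h * (h * h) ^ h \<le> n \<and>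
     ln (real h) / real h \<le> 8 * ((ln (ln (real n)))\<^sup>2 / ln (real n))"
proof -
  have "\<forall>\<^sub>F n :: nat in sequentially. 1 \<le> ln (ln (real n))" by real_asymp
  moreover have "\<forall>\<^sub>F n :: nat in sequentially. 4 \<le> ln (real n) / (4 * ln (ln (real n)))" by real_asymp
  moreover have "\<forall>\<^sub>F n :: nat in sequentially. 1 < real n" by real_asymp
  ultimately show ?thesis
  proof eventually_elim
    case (elim n)
    define x where "x = ln (real n)"
    define y where "y = ln x"
    \<comment> \<open>The tree has at most \<open>h ^ (2 * h + 1)\<close> nodes, whose logarithm is
      about \<open>2 * h * ln h\<close>. With \<open>ln h \<le> y\<close>, a quarter of
      \<open>x / y\<close> keeps it below \<open>x\<close>.\<close>
    define h where "h = nat \<lfloor>x / (4 * y)\<rfloor>"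
    have y: "1 \<le> y" and xy: "4 \<le> x / (4 * y)" using elim by (auto simp: x_def y_def)
    have x: "0 < x" using elim(3) by (simp add: x_def)
    have h: "real h \<le> x / (4 * y)" "x / (4 * y) < real h + 1"
      using xy unfolding h_def by linarith+
    have h3: "3 \<le> h" using h xy by linarith
    have "x / (4 * y) \<le> x" using x y by (simp add: divide_le_eq)
    then have "real h \<le> x" using h by linarith
    then have lnh: "ln (real h) \<le> y"
      unfolding y_def using h3 by (intro ln_mono) auto
    have ln0: "0 \<le> ln (real h)" using h3 by simp
    have "ln (real (h * (h * h) ^ h)) = real (2 * h + 1) * ln (real h)"
      using h3 by (simp add: ln_mult ln_realpow algebra_simps)
    also have "\<dots> \<le> (3 * real h) * y"
      using h3 lnh ln0 by (intro mult_mono) auto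
    also have "\<dots> \<le> (3 * (x / (4 * y))) * y"
      using h(1) y by (intro mult_right_mono) auto
    also have "\<dots> \<le> x" using x y by simp
    finally have "ln (real (h * (h * h) ^ h)) \<le> ln (real n)" by (simp add: x_def)
    then have "h * (h * h) ^ h \<le> n"
      using h3 elim(3) by (subst (asm) ln_le_cancel_iff) (auto simp del: of_nat_mult of_nat_power)
    moreover have "ln (real h) / real h \<le> 8 * (y\<^sup>2 / x)"
    proof -
      \<comment> \<open>As \<open>x / (4 * y) \<ge> 4\<close>, rounding down loses less than half,
        which gives the factor \<open>8\<close>.\<close>
      have "x / (8 * y) \<le> real h" using h(2) xy y by (simp add: field_simps)
      then have "ln (real h) / real h \<le> y / (x / (8 * y))"
        using lnh ln0 x y by (intro frac_le) auto
      also have "\<dots> = 8 * (y\<^sup>2 / x)" by (simp add: power2_eq_square)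
      finally show ?thesis .
    qed
    ultimately show ?case using h3 unfolding y_def x_def by blast
  qed
qed

theorem theorem7:
  shows "\<exists>K>0::real. \<forall>\<^sub>F n :: nat in sequentially.
    (\<exists>m E w. m \<le> n \<and> secretary_instance m E w \<and> 0 < OPT {..<m} E w \<and>
       (\<forall>R A. online_algorithm R A \<longrightarrow>
          secretary_ALG m E w R A
            \<le> K * ((ln (ln (real n)))\<^sup>2 / ln (real n)) * OPT {..<m} E w)) \<and>
    (\<exists>m E D \<pi>. m \<le> n \<and> prophet_instance m E D \<pi> \<and> 0 < prophet_OPT m E D \<and>
       (\<forall>R A. online_algorithm R A \<longrightarrow>
          prophet_ALG m E D \<pi> R A
            \<le> K * ((ln (ln (real n)))\<^sup>2 / ln (real n)) * prophet_OPT m E D))"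
proof (rule exI[of _ 96], rule conjI)
  show "\<forall>\<^sub>F n :: nat in sequentially.
    (\<exists>m E w. m \<le> n \<and> secretary_instance m E w \<and> 0 < OPT {..<m} E w \<and>
       (\<forall>R A. online_algorithm R A \<longrightarrow>
          secretary_ALG m E w R A
            \<le> 96 * ((ln (ln (real n)))\<^sup>2 / ln (real n)) * OPT {..<m} E w)) \<and>
    (\<exists>m E D \<pi>. m \<le> n \<and> prophet_instance m E D \<pi> \<and> 0 < prophet_OPT m E D \<and>
       (\<forall>R A. online_algorithm R A \<longrightarrow>
          prophet_ALG m E D \<pi> R A
            \<le> 96 * ((ln (ln (real n)))\<^sup>2 / ln (real n)) * prophet_OPT m E D))"
    using tree_parameter
  proof eventually_elim
    case (elim n)
    \<comment> \<open>The constant is \<open>96 = 12 * 8\<close>, combining the bound in terms of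
      \<open>h\<close> with the choice of \<open>h\<close>.\<close>
    let ?k = "96 * ((ln (ln (real n)))\<^sup>2 / ln (real n))"
    from elim obtain h where h: "3 \<le> h" "h * (h * h) ^ h \<le> n"
      and r: "12 * (ln (real h) / real h) \<le> ?k" by auto
    interpret interval_tree h "h * h" using h(1) by unfold_locales auto
    obtain E w where s: "secretary_instance num_present E w" "0 < OPT {..<num_present} E w"
      and sA: "\<And>R A. online_algorithm R A \<Longrightarrow>
        secretary_ALG num_present E w R A \<le> 12 * (ln (real h) / real h) * OPT {..<num_present} E w"
      using secretary_bound[OF h(1)] by blast
    obtain E' D \<pi> where p: "prophet_instance (card nodes) E' D \<pi>" "0 < prophet_OPT (card nodes) E' D"
      and pA: "\<And>R A. online_algorithm R A \<Longrightarrow> prophet_ALG (card nodes) E' D \<pi> R A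
        \<le> 12 * (ln (real h) / real h) * prophet_OPT (card nodes) E' D"
      using prophet_bound[OF h(1)] by blast
    have "secretary_ALG num_present E w R A \<le> ?k * OPT {..<num_present} E w"
      if "online_algorithm R A" for R A
      using sA[OF that] mult_right_mono[OF r less_imp_le[OF s(2)]] by linarith
    moreover have "prophet_ALG (card nodes) E' D \<pi> R A \<le> ?k * prophet_OPT (card nodes) E' D"
      if "online_algorithm R A" for R A
      using pA[OF that] mult_right_mono[OF r less_imp_le[OF p(2)]] by linarith
    moreover have "num_present \<le> n" "card nodes \<le> n"
      using num_present_le card_nodes_le h(2) by auto
    ultimately show ?case using s p by blast
  qed
qed simp

end
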